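(* For every integer $\ell\geq 2$, every finite set $P$ of at least $\mathrm{ES}\!\left(\frac{(2\ell-1)^{\ell}-1}{2\ell-2}\right)$ points in the plane contains $\ell$ collinear points or a $5$-hole.
   Context: All point sets are finite sets of distinct points in the plane $\mathbb{R}^2$. For a finite set $P$, $\mathrm{conv}(P)$ denotes its convex hull. $P$ is in general position if no three points of $P$ are collinear. $P$ is in convex position if every point of $P$ is on the boundary of $\mathrm{conv}(P)$. A point $v\in P$ is a corner of $P$ if $\mathrm{conv}(P\setminus\{v\})\neq\mathrm{conv}(P)$. $P$ is in strictly convex position if each point of $P$ is a corner of $P$. A $5$-hole (empty pentagon) of $P$ is $\mathrm{conv}(X)$ for a set $X\subseteq P$ of five points in strictly convex position with $\mathrm{conv}(X)\cap P=X$. For an integer $k$, $\mathrm{ES}(k)$ denotes the minimum integer such that every set of at least $\mathrm{ES}(k)$ points in general position in the plane contains $k$ points in convex position (it exists by the Erdős–Szekeres Theorem). The quantity $\frac{(2\ell-1)^{\ell}-1}{2\ell-2}$ is an integer. *)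

theory Defs
  imports "HOL-Analysis.Analysis"
begin

type_synonym point = "real ^ 2"

definition general_position :: "point set \<Rightarrow> bool" where
  "general_position P \<longleftrightarrow> \<not> (\<exists>X. X \<subseteq> P \<and> card X = 3 \<and> collinear X)"

definition convex_position :: "point set \<Rightarrow> bool" where
  "convex_position P \<longleftrightarrow> (\<forall>v\<in>P. v \<in> frontier (convex hull P))"

definition corner :: "point set \<Rightarrow> point \<Rightarrow> bool" where
  "corner P v \<longleftrightarrow> v \<in> P \<and> convex hull (P - {v}) \<noteq> convex hull P"

definition strictly_convex_position :: "point set \<Rightarrow> bool" where
  "strictly_convex_position P \<longleftrightarrow> (\<forall>v\<in>P. corner P v)"

definition five_hole :: "point set \<Rightarrow> point set \<Rightarrow> bool" where
  "five_hole P H \<longleftrightarrow>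
     (\<exists>X. X \<subseteq> P \<and> card X = 5 \<and> strictly_convex_position X \<and>
          convex hull X \<inter> P = X \<and> H = convex hull X)"

text \<open>
  The Erdos--Szekeres number. The set of admissible \<open>n\<close> is nonempty by the
  Erdos--Szekeres Theorem, so \<open>LEAST\<close> is a genuine minimum.
\<close>

definition ES :: "nat \<Rightarrow> nat" where
  "ES k = (LEAST n. \<forall>P. finite P \<and> card P \<ge> n \<and> general_position P \<longrightarrow>
                       (\<exists>X. X \<subseteq> P \<and> card X = k \<and> convex_position X))"

text \<open>
  The argument of \<open>ES\<close> in the main statement is written with \<open>div\<close> on natural
  numbers; this division is exact.
\<close>

lemma ES_argument_exact:
  fixes l :: nat
  assumes "l \<ge> 2"
  shows "(2 * l - 2) dvd ((2 * l - 1) ^ l - 1)"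
proof -
  have "(int (2 * l - 1) - 1) dvd (int (2 * l - 1) ^ l - 1)"
    using power_diff_1_eq[of "int (2 * l - 1)" l] by simp
  moreover have "int (2 * l - 1) - 1 = int (2 * l - 2)"
    using assms by linarith
  moreover have "int (2 * l - 1) ^ l - 1 = int ((2 * l - 1) ^ l - 1)"
    using assms by (simp add: of_nat_diff)
  ultimately show ?thesis
    by (metis int_dvd_int_iff)
qed

end

theory Submission
  imports "HOL-Library.Ramsey" Defs
begin

text \<open>
  By perturbation and the definition of \<open>ES\<close>, the set contains \<open>k\<close> points in weakly convex
  position. Choose a hull, minimal under inclusion, with at least \<open>k\<close> points of \<open>P\<close> on its
  boundary, and peel off convex layers. If two points of one layer lie in a sector that is spanned
  by consecutive points of the next layer and has a deeper point of \<open>P\<close> as apex, then these five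
  points yield a 5-hole. Hence, up to the last two layers, each layer has at most twice as many
  points as the next one, and there are at least \<open>l\<close> layers. Let \<open>z\<close> lie in the \<open>l\<close>-th layer.
  By minimality the second layer is smaller than the first, so some ray from \<open>z\<close> meets both, and
  the next point of the first layer comes before the next point of the second layer. By the sector
  argument with apices in the third layer and at \<open>z\<close>, this situation propagates inwards along the
  same ray, which thus contains a point of each layer.
\<close>

section \<open>Cross products and supporting functionals\<close>

text \<open>Collinear triples are the obstacle: a layer is only weakly convex and may have many
  points on one hull edge, whereas a 5-hole must be strictly convex. Points are therefore counted in
  half-open cones at an inner point. Such a cone consists of a boundary ray, which meets a layer at
  most once, and an open cone, which carries at most one point of the next outer layer; this is the
  source of the ratio two. The sector argument needs an apex of \<open>P\<close> two layers below,
  so the last two layers are bounded separately. Without 5-holes, a set that lies on its own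
  boundary and whose hull has no further points of \<open>P\<close> has at most four vertices, and
  all its other points are on the six lines through them. This gives at most
  \<open>N = 4 + 6 * (l - 3)\<close> points, and two such layers lead to \<open>N * (N + 1)\<close>.
  With fewer than \<open>l\<close> layers, the outer one would have at most
  \<open>2 ^ (l - 3) * (N * (N + 1))\<close> points, which is less than
  \<open>(2 * l - 1) ^ (l - 1)\<close>, the top term of the geometric sum in the argument of
  \<open>ES\<close>.\<close>

definition cross :: "point \<Rightarrow> point \<Rightarrow> real" where
  "cross u w = u$1 * w$2 - u$2 * w$1"

text \<open>Counterclockwise rotation by a right angle. It turns \<open>cross u\<close> into an
  inner product, so that oriented side conditions become half-planes given by linear
  functionals.\<close>

definition perp :: "point \<Rightarrow> point" where
  "perp u = vector [- u$2, u$1]"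

lemma inner_perp: "perp u \<bullet> w = cross u w"
  by (simp add: perp_def cross_def inner_vec_def sum_2)

lemma perp_eq_0_iff [simp]: "perp u = 0 \<longleftrightarrow> u = 0"
  by (auto simp: perp_def vec_eq_iff forall_2)

lemma cross_add_left: "cross (u + u') w = cross u w + cross u' w"
  and cross_add_right: "cross u (w + w') = cross u w + cross u w'"
  and cross_diff_left: "cross (u - u') w = cross u w - cross u' w"
  and cross_diff_right: "cross u (w - w') = cross u w - cross u w'"
  and cross_scaleR_left: "cross (c *\<^sub>R u) w = c * cross u w"
  and cross_scaleR_right: "cross u (c *\<^sub>R w) = c * cross u w"
  and cross_minus_left: "cross (- u) w = - cross u w"
  and cross_minus_right: "cross u (- w) = - cross u w"
  and cross_self [simp]: "cross u u = 0"
  and cross_zero [simp]: "cross 0 w = 0" "cross u 0 = 0"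
  by (simp_all add: cross_def algebra_simps)

lemma cross_commute: "cross w u = - cross u w"
  by (simp add: cross_def)

lemmas cross_simps = cross_add_left cross_add_right cross_diff_left cross_diff_right
  cross_scaleR_left cross_scaleR_right cross_minus_left cross_minus_right

text \<open>Cramer's rule. The signs of the coefficients are read off from cross products, which is
  how membership in cones is tested later.\<close>

lemma cross_basis:
  assumes "cross v v' \<noteq> 0"
  obtains a b where "w = a *\<^sub>R v + b *\<^sub>R v'"
    "cross v w = b * cross v v'" "cross w v' = a * cross v v'"
proof -
  let ?a = "cross w v' / cross v v'" and ?b = "cross v w / cross v v'"
  have "cross v v' *\<^sub>R w = cross w v' *\<^sub>R v + cross v w *\<^sub>R v'"
    by (simp add: cross_def vec_eq_iff forall_2 algebra_simps)
  then have "w = ?a *\<^sub>R v + ?b *\<^sub>R v'"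
    using assms by (simp add: vec_eq_iff forall_2 field_simps)
  with assms show ?thesis
    by (intro that[of ?a ?b]) auto
qed

text \<open>Divided by \<open>cross d w * cross d w'\<close>, this says that the cotangent of the
  angle from \<open>d\<close> decreases when a vector left of \<open>d\<close> turns
  counterclockwise.\<close>

lemma inner_cross_swap: "(d \<bullet> w) * cross d w' - (d \<bullet> w') * cross d w = (d \<bullet> d) * cross w w'"
  by (simp add: cross_def inner_vec_def sum_2 algebra_simps)

lemma parallel_in_half_plane:
  assumes "cross d x > 0" "cross d y > 0" "cross x y = 0"
  obtains c where "c > 0" "y = c *\<^sub>R x"
proof -
  obtain a b where y: "y = a *\<^sub>R d + b *\<^sub>R x" and b: "cross d y = b * cross d x"
    and a: "cross y x = a * cross d x"
    using cross_basis[of d x y] assms by auto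
  have "a = 0" using a assms cross_commute[of x y] by auto
  moreover have "b > 0" using b assms by (simp add: zero_less_mult_iff)
  ultimately show ?thesis using y that by simp
qed

section \<open>Boundary layers, peeling and supporting functionals\<close>

definition boundary :: "point set \<Rightarrow> point set" where
  "boundary Q = {x\<in>Q. \<exists>a. a \<noteq> 0 \<and> (\<forall>q\<in>Q. a \<bullet> q \<le> a \<bullet> x)}"

text \<open>Points in the relative interior of a hull edge also have a supporting line, so they
  leave together with the vertices, and only points interior to the hull remain.\<close>

definition peel :: "point set \<Rightarrow> point set" where
  "peel Q = Q - boundary Q"

text \<open>Means that \<open>z\<close> is interior to the convex hull of \<open>Q\<close>, in a
  form that can be tested against supporting functionals. The point \<open>z\<close> need not belong
  to \<open>Q\<close> or \<open>P\<close>.\<close>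

definition surrounds :: "point set \<Rightarrow> point \<Rightarrow> bool" where
  "surrounds Q z \<longleftrightarrow> (\<forall>a. a \<noteq> 0 \<longrightarrow> (\<exists>q\<in>Q. a \<bullet> z < a \<bullet> q))"

text \<open>Ensures that every point of \<open>P\<close> found in the hull of a subset of
  \<open>Q\<close> belongs to \<open>Q\<close>, so that emptiness with respect to \<open>P\<close>
  can be checked inside \<open>Q\<close>.\<close>

definition hull_closed :: "point set \<Rightarrow> point set \<Rightarrow> bool" where
  "hull_closed P Q \<longleftrightarrow> Q \<subseteq> P \<and> P \<inter> convex hull Q \<subseteq> Q"

lemma boundaryI: "v \<in> Q \<Longrightarrow> a \<noteq> 0 \<Longrightarrow> (\<And>q. q \<in> Q \<Longrightarrow> a \<bullet> q \<le> a \<bullet> v) \<Longrightarrow> v \<in> boundary Q"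
  unfolding boundary_def by blast

lemma boundary_boundary_subset: "S \<subseteq> boundary Q \<Longrightarrow> boundary S = S"
  unfolding boundary_def by blast

lemma peel_iff: "z \<in> peel Q \<longleftrightarrow> z \<in> Q \<and> surrounds Q z"
  unfolding peel_def boundary_def surrounds_def by (auto simp: not_le)

lemma peel_subset: "peel Q \<subseteq> Q" and boundary_subset: "boundary Q \<subseteq> Q"
  by (auto simp: peel_def boundary_def)

lemma boundary_maximal:
  assumes "finite Q" "a \<noteq> 0" "q \<in> Q"
  obtains v where "v \<in> boundary Q" "a \<bullet> q \<le> a \<bullet> v"
proof -
  have *: "finite Q" "Q \<noteq> {}" using assms by auto
  have "\<exists>v\<in>Q. \<forall>q\<in>Q. a \<bullet> q \<le> a \<bullet> v"
  proof -
    have "Max ((\<bullet>) a ` Q) \<in> (\<bullet>) a ` Q" using * by (intro Max_in) auto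
    then obtain v where "v \<in> Q" "a \<bullet> v = Max ((\<bullet>) a ` Q)" by auto
    with * show ?thesis by (intro bexI[of _ v]) auto
  qed
  then obtain v where "v \<in> Q" "\<forall>q\<in>Q. a \<bullet> q \<le> a \<bullet> v" by blast
  with assms show ?thesis by (intro that[of v]) (auto simp: boundary_def)
qed

lemma surrounds_boundary:
  assumes "finite Q" "surrounds Q z"
  shows "surrounds (boundary Q) z"
  unfolding surrounds_def
proof (intro allI impI)
  fix a :: point assume "a \<noteq> 0"
  then obtain q where q: "q \<in> Q" "a \<bullet> z < a \<bullet> q" using assms unfolding surrounds_def by blast
  obtain v where "v \<in> boundary Q" "a \<bullet> q \<le> a \<bullet> v" using boundary_maximal assms(1) \<open>a \<noteq> 0\<close> q(1) .
  with q show "\<exists>q\<in>boundary Q. a \<bullet> z < a \<bullet> q" by (intro bexI[of _ v]) auto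
qed

lemma boundary_supporting:
  assumes "v \<in> boundary Q"
  obtains a where "a \<noteq> 0" "\<And>q. q \<in> Q \<Longrightarrow> a \<bullet> q \<le> a \<bullet> v"
    "\<And>z. surrounds Q z \<Longrightarrow> a \<bullet> z < a \<bullet> v"
proof -
  obtain a where a: "a \<noteq> 0" "\<forall>q\<in>Q. a \<bullet> q \<le> a \<bullet> v" using assms by (auto simp: boundary_def)
  moreover from a have "a \<bullet> z < a \<bullet> v" if "surrounds Q z" for z
    using that unfolding surrounds_def by (meson less_le_trans)
  ultimately show ?thesis by (intro that[of a]) auto
qed

lemma inner_le_convex_hull:
  assumes "\<And>x. x \<in> X \<Longrightarrow> a \<bullet> x \<le> (c::real)" "p \<in> convex hull X"
  shows "a \<bullet> p \<le> c"
proof -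
  have "convex hull X \<subseteq> {x. a \<bullet> x \<le> c}"
    using assms(1) by (intro hull_minimal) (auto simp: convex_halfspace_le)
  with assms(2) show ?thesis by auto
qed

lemma inner_less_convex_hull:
  assumes "\<And>x. x \<in> X \<Longrightarrow> a \<bullet> x < (c::real)" "p \<in> convex hull X"
  shows "a \<bullet> p < c"
proof -
  have "convex hull X \<subseteq> {x. a \<bullet> x < c}"
    using assms(1) by (intro hull_minimal) (auto simp: convex_halfspace_lt)
  with assms(2) show ?thesis by auto
qed

text \<open>The slacks \<open>c - a \<bullet> x\<close> are nonnegative and have weighted sum zero,
  so all weight sits on the points that attain \<open>c\<close>.\<close>

lemma convex_hull_face:
  fixes X :: "point set"
  assumes "finite X" "\<And>x. x \<in> X \<Longrightarrow> a \<bullet> x \<le> c" "p \<in> convex hull X" "a \<bullet> p = c"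
  shows "p \<in> convex hull (X \<inter> {x. a \<bullet> x = c})"
proof -
  obtain u where u: "\<And>x. x \<in> X \<Longrightarrow> 0 \<le> u x" "sum u X = 1" "(\<Sum>x\<in>X. u x *\<^sub>R x) = p"
    using assms(3) unfolding convex_hull_finite[OF assms(1)] by auto
  have "(\<Sum>x\<in>X. u x * (c - a \<bullet> x)) = c * sum u X - a \<bullet> (\<Sum>x\<in>X. u x *\<^sub>R x)"
    by (simp add: inner_sum_right sum_subtractf sum_distrib_left algebra_simps)
  also have "\<dots> = 0" using u assms(4) by simp
  finally have "\<forall>x\<in>X. u x * (c - a \<bullet> x) = 0"
    using u(1) assms(1,2) by (subst (asm) sum_nonneg_eq_0_iff) auto
  then have z: "u x = 0" if "x \<in> X - X \<inter> {x. a \<bullet> x = c}" for x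
    using that by auto
  have "sum u (X \<inter> {x. a \<bullet> x = c}) = 1"
    using u(2) z assms(1) by (subst sum.mono_neutral_left[of X]) auto
  moreover have "(\<Sum>x\<in>X \<inter> {x. a \<bullet> x = c}. u x *\<^sub>R x) = p"
    using u(3) z assms(1) by (subst sum.mono_neutral_left[of X]) auto
  ultimately show ?thesis
    using u(1) assms(1) by (subst convex_hull_finite) (auto intro!: exI[of _ u])
qed

lemma boundary_not_in_hull_peel:
  assumes "x \<in> boundary Q"
  shows "x \<notin> convex hull (peel Q)"
proof
  assume x: "x \<in> convex hull (peel Q)"
  obtain a where "\<And>z. surrounds Q z \<Longrightarrow> a \<bullet> z < a \<bullet> x" using boundary_supporting[OF assms] by metis
  then have "a \<bullet> x < a \<bullet> x"
    by (intro inner_less_convex_hull[OF _ x]) (auto simp: peel_iff)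
  then show False by simp
qed

lemma hull_closed_peel:
  assumes "hull_closed P Q"
  shows "hull_closed P (peel Q)"
proof -
  have "convex hull (peel Q) \<subseteq> convex hull Q" by (intro hull_mono peel_subset)
  then show ?thesis
    using assms boundary_not_in_hull_peel[of _ Q] peel_subset[of Q]
    unfolding hull_closed_def by (auto simp: peel_def)
qed

lemma surrounds_mono: "surrounds Q z \<Longrightarrow> Q \<subseteq> Q' \<Longrightarrow> surrounds Q' z"
  unfolding surrounds_def by blast

text \<open>A supporting functional at one of the two points bounds the factor \<open>c\<close> by
  one; exchanging the points gives the reverse bound. Hence a ray from an interior point meets a
  layer at most once.\<close>

lemma boundary_same_direction:
  assumes "x \<in> boundary Q" "x' \<in> boundary Q" "surrounds Q z" "x' - z = c *\<^sub>R (x - z)" "c > 0"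
  shows "x = x'"
proof -
  have le: "c' \<le> 1" if y: "y \<in> boundary Q" and y': "y' \<in> Q" "y' - z = c' *\<^sub>R (y - z)" for y y' c'
  proof -
    obtain a where a: "\<And>q. q \<in> Q \<Longrightarrow> a \<bullet> q \<le> a \<bullet> y" "a \<bullet> z < a \<bullet> y"
      using boundary_supporting[OF y] assms(3) by metis
    have "a \<bullet> (y' - z) = c' * (a \<bullet> (y - z))" using y'(2) by simp
    then have "c' * (a \<bullet> (y - z)) \<le> 1 * (a \<bullet> (y - z))"
      using a(1)[OF y'(1)] by (simp add: inner_diff_right)
    then show ?thesis using a(2) by (simp only: mult_le_cancel_right) (simp add: inner_diff_right)
  qed
  have "x - z = (1/c) *\<^sub>R (x' - z)" using assms(4,5) by simp
  then have "1/c \<le> 1" using le assms(1,2) boundary_subset by blast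
  moreover have "c \<le> 1" using le assms(1,2,4) boundary_subset by blast
  ultimately have "c = 1" using assms(5) by (simp add: divide_le_eq)
  with assms(4) show ?thesis by simp
qed

lemma boundary_beyond_peel:
  assumes "x \<in> boundary Q" "v \<in> peel Q" "surrounds Q z" "x - z = c *\<^sub>R (v - z)" "c > 0"
  shows "c > 1"
proof -
  obtain a where a: "a \<bullet> v < a \<bullet> x" "a \<bullet> z < a \<bullet> x"
    using boundary_supporting[OF assms(1)] assms(2,3) by (metis peel_iff)
  have eq: "a \<bullet> (x - z) = c * (a \<bullet> (v - z))" using assms(4) by simp
  have pos: "a \<bullet> (v - z) > 0"
    using a(2) assms(5) eq by (simp add: inner_diff_right zero_less_mult_iff)
      (metis assms(5) diff_gt_0_iff_gt zero_less_mult_pos)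
  have "1 * (a \<bullet> (v - z)) < c * (a \<bullet> (v - z))"
    using a(1) unfolding eq[symmetric] by (simp add: inner_diff_right)
  then show ?thesis using pos by (simp only: mult_less_cancel_right_disj) auto
qed

section \<open>Angular neighbours and edges\<close>

lemma finite_max_exists:
  fixes f :: "'a \<Rightarrow> real"
  assumes "finite W" "W \<noteq> {}"
  obtains w where "w \<in> W" "\<And>y. y \<in> W \<Longrightarrow> f y \<le> f w"
proof -
  have "Max (f ` W) \<in> f ` W" using assms by (intro Max_in) auto
  then obtain w where "w \<in> W" "f w = Max (f ` W)" by auto
  with assms show ?thesis by (intro that[of w]) auto
qed

text \<open>Substituting the combination for \<open>p\<close> into the one for \<open>x\<close> and
  solving for \<open>x\<close> would put \<open>x\<close> in the hull of \<open>Y\<close>.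
  Consequently, replacing a polygon vertex by a point of the hull strictly reduces the points of
  \<open>P\<close> inside.\<close>

lemma anti_exchange:
  fixes x p :: "'a::euclidean_space"
  assumes "x \<notin> convex hull Y" "p \<in> convex hull (insert x Y)" "p \<noteq> x"
  shows "x \<notin> convex hull (insert p Y)"
proof
  assume x: "x \<in> convex hull (insert p Y)"
  have ne: "Y \<noteq> {}" using assms by auto
  obtain s t y where y: "s \<ge> 0" "t \<ge> 0" "s + t = 1" "y \<in> convex hull Y" "x = s *\<^sub>R p + t *\<^sub>R y"
    using x unfolding convex_hull_insert[OF ne] by auto
  obtain u v w where w: "u \<ge> 0" "v \<ge> 0" "u + v = 1" "w \<in> convex hull Y" "p = u *\<^sub>R x + v *\<^sub>R w"
    using assms(2) unfolding convex_hull_insert[OF ne] by auto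
  have "v \<noteq> 0" using w assms(3) by auto
  \<comment> \<open>The weight left on the hull of \<open>Y\<close> once the multiples of
    \<open>x\<close> are collected on one side; it is positive because \<open>p\<close> differs from
    \<open>x\<close>.\<close>
  define k where "k = t + s * v"
  have k: "k > 0"
  proof (cases "t = 0")
    case True
    then show ?thesis using y w \<open>v \<noteq> 0\<close> by (auto simp: k_def)
  next
    case False
    then show ?thesis using y w unfolding k_def by (intro add_pos_nonneg) auto
  qed
  have "x = s *\<^sub>R (u *\<^sub>R x + v *\<^sub>R w) + t *\<^sub>R y" using y(5) w(5) by simp
  then have "x = (s * u) *\<^sub>R x + ((s * v) *\<^sub>R w + t *\<^sub>R y)"
    by (simp add: scaleR_right_distrib add.assoc)
  moreover have "k *\<^sub>R x = x - (s * u) *\<^sub>R x" if "1 - s * u = k"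
    using that by (metis scaleR_left_diff_distrib scaleR_one)
  moreover have "1 - s * u = k"
  proof -
    have "s = s * (u + v)" using w(3) by simp
    with y(3) show ?thesis by (simp add: k_def algebra_simps)
  qed
  ultimately have "k *\<^sub>R x = (s * v) *\<^sub>R w + t *\<^sub>R y"
    by (metis add_diff_cancel_left')
  then have "(1/k) *\<^sub>R (k *\<^sub>R x) = (1/k) *\<^sub>R ((s * v) *\<^sub>R w + t *\<^sub>R y)" by simp
  then have "x = (1/k) *\<^sub>R ((s * v) *\<^sub>R w + t *\<^sub>R y)"
    using k by simp
  then have "x = (s * v / k) *\<^sub>R w + (t / k) *\<^sub>R y" by (simp add: scaleR_right_distrib)
  moreover have "s * v / k + t / k = 1"
  proof -
    have "s * v / k + t / k = (s * v + t) / k" by (rule add_divide_distrib[symmetric])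
    also have "s * v + t = k" by (simp add: k_def)
    finally show ?thesis using k by simp
  qed
  moreover have "0 \<le> s * v / k" "0 \<le> t / k" using y(1,2) w(2) k by simp_all
  ultimately have "x \<in> convex hull Y"
    using convexD[OF convex_convex_hull w(4) y(4)] by metis
  with assms(1) show False by simp
qed

text \<open>The face on which \<open>a\<close> takes the value at \<open>v\<close> contains at most
  \<open>w\<close>. A tie at \<open>w\<close> must be allowed, since two points of a layer may share
  their supporting line.\<close>

lemma not_in_hull_insert:
  fixes X :: "point set"
  assumes "finite X" "\<And>y. y \<in> X \<Longrightarrow> a \<bullet> y < a \<bullet> v" "a \<bullet> w \<le> a \<bullet> v" "w \<noteq> v"
  shows "v \<notin> convex hull (insert w X)"
proof
  assume "v \<in> convex hull (insert w X)"
  then have "v \<in> convex hull (insert w X \<inter> {x. a \<bullet> x = a \<bullet> v})"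
    using assms by (intro convex_hull_face) (auto intro: less_imp_le)
  moreover have "insert w X \<inter> {x. a \<bullet> x = a \<bullet> v} \<subseteq> {w}" using assms(2) by force
  ultimately have "v \<in> convex hull {w}" by (meson hull_mono subsetD)
  with assms(4) show False by simp
qed

text \<open>The reference is a direction, so that the next points of different layers can be
  compared from one common ray. Only turns of less than a straight angle are considered.\<close>

definition angular_next :: "point set \<Rightarrow> point \<Rightarrow> point \<Rightarrow> point \<Rightarrow> bool" where
  "angular_next V z d v' \<longleftrightarrow> 0 < cross d (v' - z) \<and>
     (\<forall>w\<in>V. \<not> (0 < cross d (w - z) \<and> 0 < cross (w - z) (v' - z)))"

definition in_cone :: "point \<Rightarrow> point \<Rightarrow> point \<Rightarrow> point \<Rightarrow> bool" where
  "in_cone z v v' x \<longleftrightarrow> 0 < cross (v - z) (x - z) \<and> 0 < cross (x - z) (v' - z)"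

text \<open>Oriented with \<open>Q\<close> on the left. It joins consecutive boundary points, not
  necessarily hull vertices: the supporting line may contain more points of \<open>Q\<close> outside
  the segment.\<close>

definition edge :: "point set \<Rightarrow> point \<Rightarrow> point \<Rightarrow> bool" where
  "edge Q v v' \<longleftrightarrow> v \<in> boundary Q \<and> v' \<in> boundary Q \<and> v \<noteq> v' \<and> (\<forall>q\<in>Q. 0 \<le> cross (v' - v) (q - v)) \<and>
     (\<forall>u. 0 < u \<and> u < 1 \<longrightarrow> v + u *\<^sub>R (v' - v) \<notin> Q)"

lemma surrounds_half_plane:
  assumes "surrounds V z" "d \<noteq> 0"
  shows "\<exists>w\<in>V. 0 < cross d (w - z)" "\<exists>w\<in>V. 0 < cross (w - z) d"
proof -
  have "perp d \<noteq> 0" "- perp d \<noteq> 0" using assms(2) by auto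
  with assms(1) obtain w w' where w: "w \<in> V" "perp d \<bullet> z < perp d \<bullet> w"
    and w': "w' \<in> V" "(- perp d) \<bullet> z < (- perp d) \<bullet> w'"
    unfolding surrounds_def by metis
  have "0 < cross d (w - z)" using w(2) by (simp add: inner_perp cross_diff_right)
  moreover have "0 < cross (w' - z) d"
    using w'(2) by (simp add: inner_perp cross_diff_left cross_commute[of d])
  ultimately show "\<exists>w\<in>V. 0 < cross d (w - z)" "\<exists>w\<in>V. 0 < cross (w - z) d"
    using w(1) w'(1) by blast+
qed

text \<open>The first point counterclockwise from \<open>d\<close> is the one left of
  \<open>d\<close> whose angle with \<open>d\<close> has the largest cotangent.\<close>

lemma next_exists:
  assumes "finite V" "surrounds V z" "d \<noteq> 0"
  obtains v' where "v' \<in> V" "angular_next V z d v'"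
proof -
  define W where "W = {w\<in>V. 0 < cross d (w - z)}"
  have "finite W" "W \<noteq> {}" using assms(1) surrounds_half_plane(1)[OF assms(2,3)] by (auto simp: W_def)
  then obtain v' where v': "v' \<in> W"
    "\<And>w. w \<in> W \<Longrightarrow> (d \<bullet> (w - z)) / cross d (w - z) \<le> (d \<bullet> (v' - z)) / cross d (v' - z)"
    using finite_max_exists[of W "\<lambda>w. (d \<bullet> (w - z)) / cross d (w - z)"] by metis
  have "\<not> 0 < cross (w - z) (v' - z)" if "w \<in> V" "0 < cross d (w - z)" for w
  proof
    assume "0 < cross (w - z) (v' - z)"
    then have "0 < (d \<bullet> d) * cross (w - z) (v' - z)" using assms(3) by simp
    then have "(d \<bullet> (v' - z)) * cross d (w - z) < (d \<bullet> (w - z)) * cross d (v' - z)"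
      using inner_cross_swap[of d "w - z" "v' - z"] by linarith
    moreover have "(d \<bullet> (w - z)) * cross d (v' - z) \<le> (d \<bullet> (v' - z)) * cross d (w - z)"
      using v'(2)[of w] v'(1) that by (simp add: W_def field_simps)
    ultimately show False by simp
  qed
  with v'(1) that show ?thesis by (auto simp: angular_next_def W_def)
qed

lemma prev_exists:
  assumes "finite V" "surrounds V z" "d \<noteq> 0"
  obtains v where "v \<in> V" "0 < cross (v - z) d"
    "\<And>w. w \<in> V \<Longrightarrow> 0 < cross (w - z) d \<Longrightarrow> \<not> 0 < cross (v - z) (w - z)"
proof -
  define W where "W = {w\<in>V. 0 < cross (w - z) d}"
  have "finite W" "W \<noteq> {}" using assms(1) surrounds_half_plane(2)[OF assms(2,3)] by (auto simp: W_def)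
  then obtain v where v: "v \<in> W"
    "\<And>w. w \<in> W \<Longrightarrow> (d \<bullet> (w - z)) / cross (w - z) d \<le> (d \<bullet> (v - z)) / cross (v - z) d"
    using finite_max_exists[of W "\<lambda>w. (d \<bullet> (w - z)) / cross (w - z) d"] by metis
  have "\<not> 0 < cross (v - z) (w - z)" if "w \<in> V" "0 < cross (w - z) d" for w
  proof
    assume "0 < cross (v - z) (w - z)"
    then have "0 < (d \<bullet> d) * cross (v - z) (w - z)" using assms(3) by simp
    then have "(d \<bullet> (v - z)) * cross (w - z) d < (d \<bullet> (w - z)) * cross (v - z) d"
      using inner_cross_swap[of d "v - z" "w - z"] cross_commute[of d "v - z"]
        cross_commute[of d "w - z"] by simp
    moreover have "(d \<bullet> (w - z)) * cross (v - z) d \<le> (d \<bullet> (v - z)) * cross (w - z) d"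
      using v(2)[of w] v(1) that by (simp add: W_def field_simps)
    ultimately show False by simp
  qed
  with v(1) that show ?thesis by (auto simp: W_def)
qed

lemma surrounds_not_boundary: "surrounds Q z \<Longrightarrow> v \<in> boundary Q \<Longrightarrow> v \<noteq> z"
  by (metis boundary_supporting less_irrefl)

text \<open>If \<open>x - r = a *\<^sub>R (v - r) + b *\<^sub>R (v' - r)\<close> and
  \<open>D = cross (v - r) (v' - r)\<close>, the right-hand side equals
  \<open>D * (1 - a - b)\<close>. For positive \<open>D\<close>, being beyond the edge thus means
  \<open>a + b > 1\<close>.\<close>

lemma cross_edge_cone:
  "cross (v' - v) (x - v) = cross (v - r) (v' - r) - cross (v - r) (x - r) - cross (x - r) (v' - r)"
  by (simp add: cross_def algebra_simps)

text \<open>If some \<open>q\<close> were on the wrong side of the line, take a boundary point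
  \<open>w\<close> at least as far out. Its cone coordinates at \<open>z\<close> have sum above one.
  Both positive contradicts angular adjacency; one nonpositive violates a supporting functional at
  \<open>v\<close> or \<open>v'\<close>.\<close>

lemma angular_next_edge:
  assumes fin: "finite Q" and z: "surrounds Q z" and v: "v \<in> boundary Q" "v' \<in> boundary Q"
    and angular_next: "angular_next (boundary Q) z (v - z) v'"
  shows "edge Q v v'"
proof -
  define D where "D = cross (v - z) (v' - z)"
  have D: "D > 0" using angular_next by (simp add: angular_next_def D_def)
  have ne: "v \<noteq> v'" using D by (auto simp: D_def)
  have nocone: "\<not> (a > 0 \<and> b > 0)"
    if "w \<in> boundary Q" "w - z = a *\<^sub>R (v - z) + b *\<^sub>R (v' - z)" for w a b
  proof
    assume ab: "a > 0 \<and> b > 0"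
    have "cross (v - z) (w - z) = b * D" "cross (w - z) (v' - z) = a * D"
      unfolding that(2) D_def
      by (simp_all add: cross_add_left cross_add_right cross_scaleR_left cross_scaleR_right)
    with ab D angular_next that(1) show False by (auto simp: angular_next_def)
  qed
  have side: "0 \<le> cross (v' - v) (q - v)" if q: "q \<in> Q" for q
  proof (rule ccontr)
    assume neg: "\<not> 0 \<le> cross (v' - v) (q - v)"
    obtain w where w: "w \<in> boundary Q" "- perp (v' - v) \<bullet> q \<le> - perp (v' - v) \<bullet> w"
      using boundary_maximal[OF fin _ q, of "- perp (v' - v)"] ne by auto
    obtain a b where ab: "w - z = a *\<^sub>R (v - z) + b *\<^sub>R (v' - z)"
      "cross (v - z) (w - z) = b * D" "cross (w - z) (v' - z) = a * D"
      using cross_basis[of "v - z" "v' - z" "w - z"] D unfolding D_def by (metis less_irrefl)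
    have "cross (v' - v) (w - v) = D * (1 - a - b)"
      using cross_edge_cone[of v' v w z] ab(2,3) by (simp add: D_def algebra_simps)
    then have "D * (1 - a - b) < 0"
      using w(2) neg by (simp add: inner_perp cross_diff_right)
    then have sum: "a + b > 1" using D by (simp add: mult_less_0_iff)
    have bound: False
      if "c + d > 1" "d \<le> 0" "y \<in> boundary Q" "y' \<in> Q" "w - z = c *\<^sub>R (y - z) + d *\<^sub>R (y' - z)"
      for c d y y'
    proof -
      obtain f where f: "\<And>q. q \<in> Q \<Longrightarrow> f \<bullet> q \<le> f \<bullet> y" "f \<bullet> z < f \<bullet> y"
        using boundary_supporting[OF \<open>y \<in> boundary Q\<close>] z by metis
      have eq: "f \<bullet> (w - z) = c * (f \<bullet> (y - z)) + d * (f \<bullet> (y' - z))"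
        unfolding that(5) by (simp add: inner_add_right)
      have "d * (f \<bullet> (y' - z)) \<ge> d * (f \<bullet> (y - z))"
        using f(1)[OF that(4)] that(2) by (intro mult_left_mono_neg) (auto simp: inner_diff_right)
      then have "f \<bullet> (w - z) \<ge> (c + d) * (f \<bullet> (y - z))"
        unfolding eq distrib_right by linarith
      moreover have "(c + d) * (f \<bullet> (y - z)) > 1 * (f \<bullet> (y - z))"
        using f(2) that(1) by (intro mult_strict_right_mono) (auto simp: inner_diff_right)
      ultimately have "f \<bullet> w > f \<bullet> y" by (simp add: inner_diff_right)
      with f(1)[of w] w(1) boundary_subset[of Q] show False by force
    qed
    consider "a > 0 \<and> b > 0" | "b \<le> 0" | "a \<le> 0" by linarith
    then show False
    proof cases
      case 1 then show ?thesis using nocone[OF w(1) ab(1)] by simp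
    next
      case 2
      have "v' \<in> Q" using v(2) boundary_subset by blast
      from bound[OF sum 2 v(1) this ab(1)] show ?thesis .
    next
      case 3
      have "v \<in> Q" using v(1) boundary_subset by blast
      moreover have "1 < b + a" using sum by simp
      moreover have "w - z = b *\<^sub>R (v' - z) + a *\<^sub>R (v - z)" using ab(1) by (simp only: add.commute)
      ultimately show ?thesis using bound[OF _ 3 v(2)] by blast
    qed
  qed
  have seg: "v + u *\<^sub>R (v' - v) \<notin> Q" if u: "0 < u" "u < 1" for u
  proof
    assume q: "v + u *\<^sub>R (v' - v) \<in> Q"
    let ?q = "v + u *\<^sub>R (v' - v)"
    have "- perp (v' - v) \<bullet> y \<le> - perp (v' - v) \<bullet> ?q" if "y \<in> Q" for y
      using side[OF that] by (simp add: inner_perp cross_simps cross_commute[of v' v] algebra_simps)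
    then have "?q \<in> boundary Q" using q ne unfolding boundary_def by (auto intro!: exI[of _ "- perp (v' - v)"])
    moreover have "?q - z = (1 - u) *\<^sub>R (v - z) + u *\<^sub>R (v' - z)" by (simp add: algebra_simps)
    ultimately show False using nocone u by (metis diff_gt_0_iff_gt)
  qed
  show ?thesis using v ne side seg by (simp add: edge_def)
qed

lemma triangle_mem:
  fixes x r v v' :: "'a::real_vector"
  assumes "x - r = a *\<^sub>R (v - r) + b *\<^sub>R (v' - r)" "a \<ge> 0" "b \<ge> 0" "a + b \<le> 1"
  shows "x \<in> convex hull {r, v, v'}"
proof -
  have "x = (1 - a - b) *\<^sub>R r + a *\<^sub>R v + b *\<^sub>R v'" using assms(1) by (simp add: algebra_simps)
  then show ?thesis using assms unfolding convex_hull_3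
    by (intro CollectI exI[of _ "1 - a - b"] exI[of _ a] exI[of _ b]) auto
qed

lemma edge_cross:
  assumes "edge Q v v'" "surrounds Q r"
  shows "0 < cross (v - r) (v' - r)"
proof -
  have "- perp (v' - v) \<noteq> 0" using assms(1) by (auto simp: edge_def)
  then obtain q where q: "q \<in> Q" "- perp (v' - v) \<bullet> r < - perp (v' - v) \<bullet> q"
    using assms(2) unfolding surrounds_def by blast
  have "0 \<le> cross (v' - v) (q - v)" using assms(1) q(1) by (simp add: edge_def)
  then have "0 < cross (v' - v) (r - v)" using q(2) by (simp add: inner_perp cross_diff_right)
  also have "\<dots> = cross (v - r) (v' - r)" by (simp add: cross_def algebra_simps)
  finally show ?thesis .
qed

text \<open>Otherwise \<open>x\<close> would lie in the triangle \<open>r\<close>, \<open>v\<close>,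
  \<open>v'\<close>, which is contained in the hull of \<open>Q\<close>.\<close>

lemma beyond_edge:
  assumes e: "edge Q v v'" and r: "r \<in> convex hull Q" "surrounds Q r" and x: "x \<notin> convex hull Q" and c: "in_cone r v v' x"
  shows "cross (v' - v) (x - v) < 0"
proof (rule ccontr)
  assume nn: "\<not> cross (v' - v) (x - v) < 0"
  define D where "D = cross (v - r) (v' - r)"
  have D: "D > 0" using edge_cross e r(2) by (simp add: D_def)
  obtain a b where ab: "x - r = a *\<^sub>R (v - r) + b *\<^sub>R (v' - r)"
    "cross (v - r) (x - r) = b * D" "cross (x - r) (v' - r) = a * D"
    using cross_basis[of "v - r" "v' - r" "x - r"] D unfolding D_def by (metis less_irrefl)
  have "a > 0" "b > 0" using c ab D by (auto simp: in_cone_def zero_less_mult_iff)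
  moreover have "a + b \<le> 1"
  proof -
    have "D * (1 - a - b) \<ge> 0"
      using nn ab(2,3) cross_edge_cone[of v' v x r] by (simp add: D_def algebra_simps)
    then show ?thesis using D by (simp add: zero_le_mult_iff)
  qed
  ultimately have "x \<in> convex hull {r, v, v'}" using triangle_mem[OF ab(1)] by simp
  moreover have "{r, v, v'} \<subseteq> convex hull Q"
    using e r boundary_subset[of Q] hull_subset[of Q convex] by (auto simp: edge_def)
  ultimately show False using x by (meson convex_convex_hull hull_minimal subsetD)
qed

section \<open>The sector argument\<close>

lemma strictly_convex_positionI:
  assumes "\<And>x. x \<in> X \<Longrightarrow> x \<notin> convex hull (X - {x})"
  shows "strictly_convex_position X"
  unfolding strictly_convex_position_def corner_def
  by (metis assms hull_inc)

lemma five_holeI: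
  assumes "X \<subseteq> P" "card X = 5" "\<And>x. x \<in> X \<Longrightarrow> x \<notin> convex hull (X - {x})"
    "P \<inter> convex hull X \<subseteq> X"
  shows "\<exists>H. five_hole P H"
proof -
  have "strictly_convex_position X" using assms(3) by (rule strictly_convex_positionI)
  moreover have "convex hull X \<inter> P = X" using assms(1,4) hull_subset[of X convex] by auto
  ultimately show ?thesis unfolding five_hole_def using assms(1,2) by metis
qed

lemma perp_less_iff:
  "perp (v - r) \<bullet> y < perp (v - r) \<bullet> y' \<longleftrightarrow> cross (v - r) (y - r) < cross (v - r) (y' - r)"
  "perp (v - r) \<bullet> y \<le> perp (v - r) \<bullet> y' \<longleftrightarrow> cross (v - r) (y - r) \<le> cross (v - r) (y' - r)"
  by (simp_all add: inner_perp cross_diff_right)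

lemma perp_less_iff':
  "perp (v - r) \<bullet> y < perp (v - r) \<bullet> y' \<longleftrightarrow> cross (y' - r) (v - r) < cross (y - r) (v - r)"
  "perp (v - r) \<bullet> y \<le> perp (v - r) \<bullet> y' \<longleftrightarrow> cross (y' - r) (v - r) \<le> cross (y - r) (v - r)"
  unfolding perp_less_iff cross_commute[of "v - r"] by simp_all

lemma in_cone_convex: "convex {x. in_cone z v v' x}"
proof -
  have "{x. in_cone z v v' x} =
    {x. perp (v - z) \<bullet> x > perp (v - z) \<bullet> z} \<inter> {x. perp (v' - z) \<bullet> x < perp (v' - z) \<bullet> z}"
    unfolding perp_less_iff[of v] perp_less_iff'[of v'] by (auto simp: in_cone_def)
  then show ?thesis by (simp only: convex_Int convex_halfspace_gt convex_halfspace_lt)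
qed

text \<open>Effect of moving the apex of a cone from the origin to \<open>p\<close> on the two cross
  products that define the cone.\<close>

lemma cross_shift:
  fixes V V' Y :: point and a b :: real
  defines "p \<equiv> a *\<^sub>R V + b *\<^sub>R V'"
  shows "cross (V - p) (Y - p) = (1 - a) * cross V Y + b * (cross Y V' - cross V V')"
    and "cross (Y - p) (V' - p) = (1 - b) * cross Y V' + a * (cross V Y - cross V V')"
  by (simp_all add: p_def cross_def algebra_simps)

text \<open>The fifth point \<open>r\<close> may be moved towards the edge and \<open>x\<close>, \<open>x'\<close> towards each other until
  the pentagon \<open>r, v, x, x', v'\<close> is empty.\<close>

lemma sector:
  assumes fin: "finite P" and cl: "hull_closed P Q" and e: "edge (peel Q) v v'"
    and r: "r \<in> peel (peel Q)" and x: "x \<in> boundary Q" "x' \<in> boundary Q" "x \<noteq> x'"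
    and cone: "in_cone r v v' x" "in_cone r v v' x'"
  shows "\<exists>H. five_hole P H"
  using r x cone
proof (induction "card (P \<inter> convex hull {r, v, v', x, x'})" arbitrary: r x x' rule: less_induct)
  case less
  let ?X = "{r, v, v', x, x'}"
  define D where "D = cross (v - r) (v' - r)"
  note r = less.prems(1) and x = less.prems(2) and x' = less.prems(3) and xx' = less.prems(4)
    and cx = less.prems(5) and cx' = less.prems(6)
  have clI: "hull_closed P (peel Q)" using cl by (rule hull_closed_peel)
  have rI: "r \<in> peel Q" "surrounds (peel Q) r" using r by (auto simp: peel_iff)
  have vI: "v \<in> peel Q" "v' \<in> peel Q" using e boundary_subset by (auto simp: edge_def)
  have D: "D > 0" using edge_cross[OF e rI(2)] by (simp add: D_def)
  have beyond: "cross (v' - v) (y - v) < 0" "cross (v - r) (y - r) + cross (y - r) (v' - r) > D"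
    if "y \<in> boundary Q" "in_cone r v v' y" for y
  proof -
    show "cross (v' - v) (y - v) < 0"
      using beyond_edge[OF e hull_inc[OF rI(1)] rI(2)] boundary_not_in_hull_peel that by blast
    then show "cross (v - r) (y - r) + cross (y - r) (v' - r) > D"
      using cross_edge_cone[of v' v y r] by (simp add: D_def)
  qed
  have sub: "?X \<subseteq> Q" using rI vI x x' boundary_subset peel_subset by blast
  have disj: "y \<notin> boundary Q" if "y \<in> peel Q" for y using that by (simp add: peel_def)
  have ne: "r \<noteq> v" "r \<noteq> v'" "v \<noteq> v'" using D by (auto simp: D_def)
  have dist: "distinct [r, v, v', x, x']"
    using ne xx' disj[OF rI(1)] disj[OF vI(1)] disj[OF vI(2)] x x' by auto
  have card: "card ?X = 5" using dist by (simp add: card_insert_if)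
  have sc_r: "r \<notin> convex hull {v, v', x, x'}"
  proof
    assume "r \<in> convex hull {v, v', x, x'}"
    moreover have "0 < cross (v' - v) (r - v)"
      using D cross_edge_cone[of v' v r r] by (simp add: D_def)
    ultimately have "perp (v' - v) \<bullet> r < perp (v' - v) \<bullet> r"
      using beyond(1)[OF x cx] beyond(1)[OF x' cx']
      by - (rule inner_less_convex_hull[of "{v, v', x, x'}"], auto simp: perp_less_iff)
    then show False by simp
  qed
  have sc_v: "v \<notin> convex hull {r, v', x, x'}"
    by (rule not_in_hull_insert[of _ "- perp (v - r)"])
       (use D cx cx' ne in \<open>auto simp: perp_less_iff D_def in_cone_def\<close>)
  have sc_v': "v' \<notin> convex hull {r, v, x, x'}"
    by (rule not_in_hull_insert[of _ "perp (v' - r)"])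
       (use D cx cx' ne in \<open>auto simp: perp_less_iff' D_def in_cone_def\<close>)
  have sc_x: "y \<notin> convex hull {y', r, v, v'}"
    if y: "y \<in> boundary Q" "y' \<in> boundary Q" "y \<noteq> y'" for y y'
  proof -
    obtain a where a: "\<And>q. q \<in> Q \<Longrightarrow> a \<bullet> q \<le> a \<bullet> y" "\<And>z. surrounds Q z \<Longrightarrow> a \<bullet> z < a \<bullet> y"
      using boundary_supporting[OF y(1)] by metis
    show ?thesis
      by (rule not_in_hull_insert[of _ a]) (use a y rI vI boundary_subset in \<open>auto simp: peel_iff\<close>)
  qed
  have strict: "y \<notin> convex hull (?X - {y})" if mem: "y \<in> ?X" for y
  proof -
    have eqs: "?X - {r} = {v, v', x, x'}" "?X - {v} = {r, v', x, x'}" "?X - {v'} = {r, v, x, x'}"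
      "?X - {x} = {x', r, v, v'}" "?X - {x'} = {x, r, v, v'}"
      using dist by auto
    consider "y = r" | "y = v" | "y = v'" | "y = x" | "y = x'" using mem by blast
    then show ?thesis
    proof cases
      case 1 show ?thesis unfolding 1 eqs by (rule sc_r)
    next
      case 2 show ?thesis unfolding 2 eqs by (rule sc_v)
    next
      case 3 show ?thesis unfolding 3 eqs by (rule sc_v')
    next
      case 4 show ?thesis unfolding 4 eqs by (rule sc_x[OF x x' xx'])
    next
      case 5 show ?thesis unfolding 5 eqs by (rule sc_x[OF x' x xx'[symmetric]])
    qed
  qed
  \<comment> \<open>Exchanging the vertex \<open>w\<close> for a point \<open>p\<close> of the
    pentagon expels \<open>w\<close> from the hull by anti-exchange, so the new pentagon contains
    fewer points of \<open>P\<close>.\<close>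
  have IH: "\<exists>H. five_hole P H"
    if s: "s \<in> peel (peel Q)" and y: "y \<in> boundary Q" "y' \<in> boundary Q" "y \<noteq> y'"
      "in_cone s v v' y" "in_cone s v v' y'"
      and w: "w \<in> ?X" "p \<in> P" "p \<in> convex hull ?X" "p \<noteq> w"
      and eq: "{s, v, v', y, y'} = insert p (?X - {w})" for s y y' w p
  proof -
    have w': "w \<notin> convex hull (insert p (?X - {w}))"
      using anti_exchange[OF strict[OF w(1)], of p] w insert_absorb[of w ?X] by simp
    have "insert p (?X - {w}) \<subseteq> convex hull ?X"
      using w(3) hull_subset[of ?X convex] by auto
    then have "convex hull (insert p (?X - {w})) \<subseteq> convex hull ?X"
      by (meson convex_convex_hull hull_minimal)
    moreover have "w \<in> P" using w(1) sub cl by (auto simp: hull_closed_def)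
    moreover have "w \<in> convex hull ?X" using w(1) by (rule hull_inc)
    ultimately have "P \<inter> convex hull (insert p (?X - {w})) \<subset> P \<inter> convex hull ?X"
      using w' by blast
    then have "card (P \<inter> convex hull {s, v, v', y, y'}) < card (P \<inter> convex hull ?X)"
      unfolding eq using fin by (intro psubset_card_mono) auto
    from less.hyps[OF this s y] show ?thesis .
  qed
  show ?case
  proof (cases "P \<inter> convex hull ?X \<subseteq> ?X")
    case True
    have "?X \<subseteq> P" using sub cl by (auto simp: hull_closed_def)
    then show ?thesis using five_holeI[OF _ card strict True] by blast
  next
    case False
    then obtain p where p: "p \<in> P" "p \<in> convex hull ?X" "p \<notin> ?X" by blast
    have pQ: "p \<in> Q" using p(1,2) hull_mono[OF sub, of convex] cl by (auto simp: hull_closed_def)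
    show ?thesis
    proof (cases "p \<in> boundary Q")
      case True
      \<comment> \<open>A supporting functional at \<open>p\<close> is strict at \<open>r\<close>,
        \<open>v\<close> and \<open>v'\<close>, which lie in inner layers. So \<open>p\<close> is on
        the segment from \<open>x\<close> to \<open>x'\<close>, hence in the cone, and may replace
        \<open>x\<close>.\<close>
      obtain a where a: "\<And>q. q \<in> Q \<Longrightarrow> a \<bullet> q \<le> a \<bullet> p" "\<And>z. surrounds Q z \<Longrightarrow> a \<bullet> z < a \<bullet> p"
        using boundary_supporting[OF True] by metis
      have "p \<in> convex hull (?X \<inter> {y. a \<bullet> y = a \<bullet> p})"
        using a sub p(2) by (intro convex_hull_face) auto
      moreover have "?X \<inter> {y. a \<bullet> y = a \<bullet> p} \<subseteq> {x, x'}"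
      proof -
        have "a \<bullet> r \<noteq> a \<bullet> p" "a \<bullet> v \<noteq> a \<bullet> p" "a \<bullet> v' \<noteq> a \<bullet> p"
          using a(2)[of r] a(2)[of v] a(2)[of v'] rI vI by (simp_all add: peel_iff)
        then show ?thesis by auto
      qed
      ultimately have "p \<in> convex hull {x, x'}" by (meson hull_mono subsetD)
      also have "convex hull {x, x'} \<subseteq> {y. in_cone r v v' y}"
        using cx cx' by (intro hull_minimal in_cone_convex) auto
      finally have "in_cone r v v' p" by simp
      moreover have "{r, v, v', p, x'} = insert p (?X - {x})" using dist by auto
      ultimately show ?thesis
        using IH[of r p x' x p] r True x' p cx' by auto
    next
      case False
      then have pI: "p \<in> peel Q" using pQ by (simp add: peel_def)
      \<comment> \<open>The coordinates of \<open>p\<close> are nonnegative because the pentagon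
        lies in the closed cone at \<open>r\<close>, and their sum is at most one because the edge
        supports \<open>peel Q\<close>. Sum one would put \<open>p\<close> on the edge, which has no
        point of \<open>peel Q\<close> besides its ends. So \<open>p\<close> is below the edge and
        may replace \<open>r\<close>.\<close>
      obtain a b where ab: "p - r = a *\<^sub>R (v - r) + b *\<^sub>R (v' - r)"
        "cross (v - r) (p - r) = b * D" "cross (p - r) (v' - r) = a * D"
        using cross_basis[of "v - r" "v' - r" "p - r"] D unfolding D_def by (metis less_irrefl)
      have "- perp (v - r) \<bullet> p \<le> - perp (v - r) \<bullet> r"
        using D cx cx' p(2) by - (rule inner_le_convex_hull[of ?X],
          auto simp: perp_less_iff D_def in_cone_def)
      then have "0 \<le> b * D" using ab(2) by (simp add: perp_less_iff)
      moreover have "perp (v' - r) \<bullet> p \<le> perp (v' - r) \<bullet> r"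
        using D cx cx' p(2) by - (rule inner_le_convex_hull[of ?X],
          auto simp: perp_less_iff' D_def in_cone_def)
      then have "0 \<le> a * D" using ab(3) by (simp add: perp_less_iff')
      ultimately have nn: "0 \<le> a" "0 \<le> b" using D by (auto simp: zero_le_mult_iff)
      have "0 \<le> cross (v' - v) (p - v)" using e pI by (simp add: edge_def)
      then have "0 \<le> D * (1 - a - b)"
        using cross_edge_cone[of v' v p r] ab(2,3) by (simp add: D_def algebra_simps)
      then have le1: "a + b \<le> 1" using D by (simp add: zero_le_mult_iff)
      have "a + b \<noteq> 1"
      proof
        assume "a + b = 1"
        then have a: "a = 1 - b" by simp
        have pb: "p = v + b *\<^sub>R (v' - v)"
          using ab(1) unfolding a by (simp add: algebra_simps)
        have "b = 0 \<or> b = 1 \<or> (0 < b \<and> b < 1)" using nn a by auto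
        then show False using pb p(3) e pI by (auto simp: edge_def)
      qed
      with le1 have lt1: "a + b < 1" by simp
      have pII: "p \<in> peel (peel Q)"
      proof (rule ccontr)
        assume "p \<notin> peel (peel Q)"
        then have "p \<in> boundary (peel Q)" using pI by (simp add: peel_def)
        then obtain f where f: "\<And>q. q \<in> peel Q \<Longrightarrow> f \<bullet> q \<le> f \<bullet> p" "f \<bullet> r < f \<bullet> p"
          using boundary_supporting rI(2) by metis
        have "f \<bullet> (p - r) = a * (f \<bullet> (v - r)) + b * (f \<bullet> (v' - r))"
          unfolding ab(1) by (simp add: inner_add_right)
        also have "\<dots> \<le> a * (f \<bullet> (p - r)) + b * (f \<bullet> (p - r))"
          using f(1)[OF vI(1)] f(1)[OF vI(2)] nn
          by (intro add_mono mult_left_mono) (auto simp: inner_diff_right)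
        also have "\<dots> = (a + b) * (f \<bullet> (p - r))" by (simp add: algebra_simps)
        also have "\<dots> < 1 * (f \<bullet> (p - r))"
          using lt1 f(2) by (intro mult_strict_right_mono) (auto simp: inner_diff_right)
        finally show False by simp
      qed
      \<comment> \<open>Points beyond the edge stay in the cone when the apex moves to
        \<open>p\<close>: since \<open>\<alpha> + \<beta> > D\<close>, each cross product is at
        least \<open>1 - a - b\<close> times a positive number.\<close>
      have conep: "in_cone p v v' y" if y: "y \<in> boundary Q" "in_cone r v v' y" for y
      proof -
        define \<alpha> \<beta> where "\<alpha> = cross (v - r) (y - r)" and "\<beta> = cross (y - r) (v' - r)"
        have pos: "\<alpha> > 0" "\<beta> > 0" "\<alpha> + \<beta> > D"
          using y beyond(2) by (auto simp: in_cone_def \<alpha>_def \<beta>_def)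
        have eqs: "v - p = (v - r) - (p - r)" "y - p = (y - r) - (p - r)" "v' - p = (v' - r) - (p - r)"
          by auto
        have e1: "cross (v - p) (y - p) = (1 - a) * \<alpha> + b * (\<beta> - D)"
          unfolding eqs ab(1) \<alpha>_def \<beta>_def D_def by (rule cross_shift)
        have "b * (\<beta> - D) \<ge> b * (- \<alpha>)" using pos nn by (intro mult_left_mono) auto
        then have "cross (v - p) (y - p) \<ge> (1 - a - b) * \<alpha>"
          unfolding e1 left_diff_distrib by simp
        moreover have "(1 - a - b) * \<alpha> > 0" using lt1 pos by simp
        ultimately have 1: "cross (v - p) (y - p) > 0" by linarith
        have e2: "cross (y - p) (v' - p) = (1 - b) * \<beta> + a * (\<alpha> - D)"
          unfolding eqs ab(1) \<alpha>_def \<beta>_def D_def by (rule cross_shift)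
        have "a * (\<alpha> - D) \<ge> a * (- \<beta>)" using pos nn by (intro mult_left_mono) auto
        then have "cross (y - p) (v' - p) \<ge> (1 - a - b) * \<beta>"
          unfolding e2 left_diff_distrib by simp
        moreover have "(1 - a - b) * \<beta> > 0" using lt1 pos by simp
        ultimately have 2: "cross (y - p) (v' - p) > 0" by linarith
        from 1 2 show ?thesis by (simp add: in_cone_def)
      qed
      have "{p, v, v', x, x'} = insert p (?X - {r})" using dist by auto
      then show ?thesis
        using IH[OF pII x x' xx' conep[OF x cx] conep[OF x' cx'], of r p] p by auto
    qed
  qed
qed

section \<open>Aligned layers\<close>

definition next_point :: "point set \<Rightarrow> point \<Rightarrow> point \<Rightarrow> point" where
  "next_point Q z v = (SOME v'. v' \<in> boundary Q \<and> angular_next (boundary Q) z (v - z) v')"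

definition on_ray :: "point \<Rightarrow> point \<Rightarrow> point \<Rightarrow> bool" where
  "on_ray z d x \<longleftrightarrow> (\<exists>c>0. x - z = c *\<^sub>R d)"

lemma finite_boundary: "finite Q \<Longrightarrow> finite (boundary Q)"
  using boundary_subset finite_subset by blast

lemma finite_peel: "finite Q \<Longrightarrow> finite (peel Q)"
  using peel_subset finite_subset by blast

lemma next_point:
  assumes "finite Q" "surrounds Q z" "v \<in> boundary Q"
  shows "next_point Q z v \<in> boundary Q" "angular_next (boundary Q) z (v - z) (next_point Q z v)" "edge Q v (next_point Q z v)"
proof -
  have "v \<noteq> z" using surrounds_not_boundary assms(2,3) by blast
  then obtain v' where "v' \<in> boundary Q \<and> angular_next (boundary Q) z (v - z) v'"
    using next_exists[OF finite_boundary[OF assms(1)] surrounds_boundary[OF assms(1,2)], of "v - z"] by auto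
  then have "next_point Q z v \<in> boundary Q \<and> angular_next (boundary Q) z (v - z) (next_point Q z v)"
    unfolding next_point_def by (rule someI)
  then show "next_point Q z v \<in> boundary Q" "angular_next (boundary Q) z (v - z) (next_point Q z v)" by auto
  then show "edge Q v (next_point Q z v)" using angular_next_edge assms by blast
qed

text \<open>Let \<open>v\<close> be the last boundary point before \<open>x\<close>
  counterclockwise. If its successor did not come after \<open>x\<close>, it would lie strictly
  between \<open>v\<close> and \<open>x\<close>, against the choice of \<open>v\<close>, or on the
  ray through \<open>x\<close>.\<close>

lemma half_cone_cover:
  assumes "finite Q" "surrounds Q z" "x \<noteq> z"
  obtains v where "v \<in> boundary Q" "on_ray z (v - z) x \<or> in_cone z v (next_point Q z v) x"
proof (cases "\<exists>v\<in>boundary Q. on_ray z (v - z) x")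
  case True
  then show ?thesis using that by blast
next
  case False
  obtain v where v: "v \<in> boundary Q" "0 < cross (v - z) (x - z)"
    "\<And>w. w \<in> boundary Q \<Longrightarrow> 0 < cross (w - z) (x - z) \<Longrightarrow> \<not> 0 < cross (v - z) (w - z)"
    using prev_exists[OF finite_boundary[OF assms(1)] surrounds_boundary[OF assms(1,2)], of "x - z"] assms(3)
    by auto
  let ?v' = "next_point Q z v"
  have v': "?v' \<in> boundary Q" "0 < cross (v - z) (?v' - z)"
    using next_point[OF assms(1,2) v(1)] by (auto simp: angular_next_def)
  have "0 < cross (x - z) (?v' - z)"
  proof (rule ccontr)
    assume "\<not> 0 < cross (x - z) (?v' - z)"
    moreover have "\<not> 0 < cross (?v' - z) (x - z)" using v(3)[OF v'(1)] v'(2) by blast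
    ultimately have "cross (?v' - z) (x - z) = 0" using cross_commute[of "x - z" "?v' - z"] by linarith
    then obtain c where "c > 0" "x - z = c *\<^sub>R (?v' - z)"
      using parallel_in_half_plane[OF v'(2) v(2)] by blast
    with False v'(1) show False by (auto simp: on_ray_def)
  qed
  then show ?thesis using that v by (auto simp: in_cone_def)
qed

lemma on_ray_unique:
  assumes "surrounds Q z" "x \<in> boundary Q" "x' \<in> boundary Q" "on_ray z d x" "on_ray z d x'"
  shows "x = x'"
proof -
  obtain c c' where c: "c > 0" "x - z = c *\<^sub>R d" "c' > 0" "x' - z = c' *\<^sub>R d"
    using assms by (auto simp: on_ray_def)
  then have "x' - z = (c' / c) *\<^sub>R (x - z)" "c' / c > 0" by simp_all
  then show ?thesis by (rule boundary_same_direction[OF assms(2,3,1)])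
qed

text \<open>Pigeonhole principle for the half-open cones, which cover everything except
  \<open>z\<close>. It is applied with \<open>m\<close> equal to \<open>1\<close>, \<open>2\<close>
  and \<open>N + 1\<close>.\<close>

lemma half_cone_count:
  assumes fin: "finite Q" "finite A" and z: "surrounds Q z" "surrounds B z" and A: "A \<subseteq> boundary B"
    and m: "\<And>v. v \<in> boundary Q \<Longrightarrow> card {x\<in>A. on_ray z (v - z) x \<or> in_cone z v (next_point Q z v) x} \<le> m"
  shows "card A \<le> m * card (boundary Q)"
proof -
  let ?H = "\<lambda>v. {x\<in>A. on_ray z (v - z) x \<or> in_cone z v (next_point Q z v) x}"
  have "A \<subseteq> (\<Union>v\<in>boundary Q. ?H v)"
  proof
    fix x assume x: "x \<in> A"
    then have "x \<noteq> z" using surrounds_not_boundary z(2) A by blast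
    then obtain v where "v \<in> boundary Q" "on_ray z (v - z) x \<or> in_cone z v (next_point Q z v) x"
      using half_cone_cover[OF fin(1) z(1)] by blast
    with x show "x \<in> (\<Union>v\<in>boundary Q. ?H v)" by blast
  qed
  then have "card A \<le> card (\<Union>v\<in>boundary Q. ?H v)"
    using fin finite_boundary by (intro card_mono) auto
  also have "\<dots> \<le> (\<Sum>v\<in>boundary Q. card (?H v))"
    using fin finite_boundary by (intro card_UN_le) auto
  also have "\<dots> \<le> (\<Sum>v\<in>boundary Q. m)" using m by (intro sum_mono) auto
  finally show ?thesis by (simp add: mult.commute)
qed

lemma on_ray_card:
  assumes "finite A" "surrounds B z" "A \<subseteq> boundary B"
  shows "card {x\<in>A. on_ray z d x} \<le> 1"
proof -
  have "\<forall>x\<in>{x\<in>A. on_ray z d x}. \<forall>x'\<in>{x\<in>A. on_ray z d x}. x = x'"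
    using on_ray_unique[OF assms(2)] assms(3) by blast
  then show ?thesis using assms(1) card_le_Suc0_iff_eq[of "{x\<in>A. on_ray z d x}"] by simp
qed

lemma sector_card:
  assumes "finite P" "hull_closed P Q" "\<nexists>H. five_hole P H" "z \<in> peel (peel Q)" "v \<in> boundary (peel Q)"
  shows "card {x\<in>boundary Q. in_cone z v (next_point (peel Q) z v) x} \<le> 1"
proof -
  have "finite Q" using assms(1,2) finite_subset by (auto simp: hull_closed_def)
  then have f: "finite (peel Q)" "finite (boundary Q)" by (simp_all add: finite_boundary finite_peel)
  have "surrounds (peel Q) z" using assms(4) by (simp add: peel_iff)
  then have "edge (peel Q) v (next_point (peel Q) z v)" using next_point(3) f assms(5) by blast
  from sector[OF assms(1,2) this assms(4)] assms(3)
  have "\<forall>x\<in>{x\<in>boundary Q. in_cone z v (next_point (peel Q) z v) x}.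
    \<forall>x'\<in>{x\<in>boundary Q. in_cone z v (next_point (peel Q) z v) x}. x = x'" by blast
  then show ?thesis
    using f(2) card_le_Suc0_iff_eq[of "{x\<in>boundary Q. in_cone z v (next_point (peel Q) z v) x}"] by simp
qed

text \<open>Each half-open cone contributes at most one outer point on its ray and one in its open
  part.\<close>

lemma layer_ratio:
  assumes "finite P" "hull_closed P Q" "\<nexists>H. five_hole P H" "peel (peel Q) \<noteq> {}"
  shows "card (boundary Q) \<le> 2 * card (boundary (peel Q))"
proof -
  obtain z where z: "z \<in> peel (peel Q)" using assms(4) by blast
  have s: "surrounds (peel Q) z" "surrounds Q z" using z by (auto simp: peel_iff)
  have "finite Q" using assms(1,2) finite_subset by (auto simp: hull_closed_def)
  then have f: "finite (peel Q)" "finite (boundary Q)" by (simp_all add: finite_boundary finite_peel)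
  show ?thesis
  proof (rule half_cone_count[OF f s order.refl])
    fix v assume v: "v \<in> boundary (peel Q)"
    have "{x\<in>boundary Q. on_ray z (v - z) x \<or> in_cone z v (next_point (peel Q) z v) x} =
      {x\<in>boundary Q. on_ray z (v - z) x} \<union> {x\<in>boundary Q. in_cone z v (next_point (peel Q) z v) x}" by auto
    also have "card \<dots> \<le> 1 + 1"
      using on_ray_card[OF f(2) s(2) order.refl] sector_card[OF assms(1-3) z v]
      by (intro order.trans[OF card_Un_le] add_mono) auto
    finally show "card {x\<in>boundary Q. on_ray z (v - z) x \<or> in_cone z v (next_point (peel Q) z v) x} \<le> 2" by simp
  qed
qed

lemma angular_next_scale: "c > 0 \<Longrightarrow> angular_next V z (c *\<^sub>R d) v \<longleftrightarrow> angular_next V z d v"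
  by (simp add: angular_next_def cross_scaleR_left zero_less_mult_iff)

text \<open>The ray from \<open>z\<close> in direction \<open>d\<close> meets the two outermost layers of \<open>Q\<close>, and when it is
  turned counterclockwise, it meets the outer layer again before the inner one.\<close>

definition lead :: "point set \<Rightarrow> point \<Rightarrow> point \<Rightarrow> bool" where
  "lead Q z d \<longleftrightarrow> (\<exists>x0\<in>boundary Q. \<exists>v0\<in>boundary (peel Q). \<exists>x1\<in>boundary Q. \<exists>v1\<in>boundary (peel Q).
     on_ray z d x0 \<and> on_ray z d v0 \<and> angular_next (boundary (peel Q)) z d v1 \<and>
     0 < cross d (x1 - z) \<and> 0 < cross (x1 - z) (v1 - z))"

text \<open>One point per half-open cone would make the outer layer no larger than the inner one. So
  some cone holds two outer points, and as its ray and its open part hold at most one each, both are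
  occupied.\<close>

lemma lead_exists:
  assumes "finite P" "hull_closed P Q" "\<nexists>H. five_hole P H" "z \<in> peel (peel Q)"
    and less: "card (boundary (peel Q)) < card (boundary Q)"
  shows "\<exists>d. lead Q z d"
proof -
  have s: "surrounds (peel Q) z" "surrounds Q z" using assms(4) by (auto simp: peel_iff)
  have "finite Q" using assms(1,2) finite_subset by (auto simp: hull_closed_def)
  then have f: "finite (peel Q)" "finite (boundary Q)" by (simp_all add: finite_boundary finite_peel)
  let ?H = "\<lambda>v. {x\<in>boundary Q. on_ray z (v - z) x \<or> in_cone z v (next_point (peel Q) z v) x}"
  obtain v where v: "v \<in> boundary (peel Q)" "\<not> card (?H v) \<le> 1"
    using half_cone_count[OF f s order.refl, of 1] less by fastforce
  have not_sub: "\<not> ?H v \<subseteq> B" if "B \<subseteq> boundary Q" "card B \<le> 1" for B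
  proof
    assume "?H v \<subseteq> B"
    then have "card (?H v) \<le> card B" using f(2) that(1) finite_subset by (intro card_mono) auto
    with v(2) that(2) show False by linarith
  qed
  have "\<not> ?H v \<subseteq> {x\<in>boundary Q. on_ray z (v - z) x}"
    using on_ray_card[OF f(2) s(2) order.refl] by (intro not_sub) auto
  then obtain x1 where x1: "x1 \<in> boundary Q" "in_cone z v (next_point (peel Q) z v) x1" by blast
  have "\<not> ?H v \<subseteq> {x\<in>boundary Q. in_cone z v (next_point (peel Q) z v) x}"
    using sector_card[OF assms(1-4) v(1)] by (intro not_sub) auto
  then obtain x0 where x0: "x0 \<in> boundary Q" "on_ray z (v - z) x0" by blast
  have "on_ray z (v - z) v" by (auto simp: on_ray_def intro: exI[of _ 1])
  with x0 x1 v(1) next_point[OF f(1) s(1) v(1)] have "lead Q z (v - z)"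
    unfolding lead_def in_cone_def by blast
  then show ?thesis ..
qed

text \<open>The third layer must also meet the ray and stay behind the second one: a point \<open>s\<close> of it
  that comes too early is the apex of a sector containing \<open>x0\<close> and \<open>x1\<close>, and if the ray misses
  the layer, then \<open>z\<close> is the apex of a sector containing \<open>v0\<close> and \<open>v1\<close>.\<close>

lemma lead_step:
  assumes P: "finite P" "hull_closed P Q" "\<nexists>H. five_hole P H" and z: "z \<in> peel (peel (peel Q))"
    and lead: "lead Q z d"
  shows "lead (peel Q) z d"
proof -
  define Q1 where "Q1 = peel Q"
  define Q2 where "Q2 = peel Q1"
  obtain x0 v0 x1 v1 where x: "x0 \<in> boundary Q" "x1 \<in> boundary Q" and v: "v0 \<in> boundary Q1" "v1 \<in> boundary Q1"
    and r: "on_ray z d x0" "on_ray z d v0" and angular_next: "angular_next (boundary Q1) z d v1"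
    and c1: "0 < cross d (x1 - z)" "0 < cross (x1 - z) (v1 - z)"
    using lead unfolding lead_def Q1_def by blast
  have surrounds: "surrounds Q z" "surrounds Q1 z" "surrounds Q2 z" and zQ: "z \<in> Q1"
    using z by (auto simp: Q1_def Q2_def peel_iff)
  have "finite Q" using P finite_subset by (auto simp: hull_closed_def)
  then have f: "finite Q1" "finite Q2"
    unfolding Q1_def Q2_def by (simp_all add: finite_peel)
  have cl: "hull_closed P Q1" using P(2) unfolding Q1_def by (rule hull_closed_peel)
  obtain c where c: "c > 0" "v0 - z = c *\<^sub>R d" using r(2) by (auto simp: on_ray_def)
  have d0: "d \<noteq> 0" using c(2) surrounds_not_boundary[OF surrounds(2) v(1)] by auto
  have adj0: "angular_next (boundary Q1) z (v0 - z) v1" using angular_next c by (simp add: angular_next_scale)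
  have e: "edge Q1 v0 v1" using angular_next_edge[OF f(1) surrounds(2) v adj0] .
  define D where "D = cross (v0 - z) (v1 - z)"
  have D: "D > 0" using adj0 by (simp add: angular_next_def D_def)
  have cone1: "in_cone z v0 v1 x1" using c c1 by (simp add: in_cone_def cross_scaleR_left)
  \<comment> \<open>Otherwise \<open>s\<close> would lie in the triangle \<open>z\<close>,
    \<open>v0\<close>, \<open>v1\<close>. Everything is expressed in the basis
    \<open>v0 - z\<close>, \<open>v1 - z\<close> in order to see that \<open>x0\<close> and
    \<open>x1\<close>, both beyond the edge, are in the cone at \<open>s\<close>.\<close>
  have no_early: "0 < cross (v1 - z) (s - z)" if s: "s \<in> Q2" "0 < cross d (s - z)" for s
  proof (rule ccontr)
    assume "\<not> 0 < cross (v1 - z) (s - z)"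
    then have le: "0 \<le> cross (s - z) (v1 - z)" using cross_commute[of "s - z" "v1 - z"] by simp
    obtain \<alpha> \<beta> where s_eq: "s - z = \<alpha> *\<^sub>R (v0 - z) + \<beta> *\<^sub>R (v1 - z)"
      "cross (v0 - z) (s - z) = \<beta> * D" "cross (s - z) (v1 - z) = \<alpha> * D"
      using cross_basis[of "v0 - z" "v1 - z" "s - z"] D unfolding D_def by (metis less_irrefl)
    have "0 < cross (v0 - z) (s - z)" using c s(2) by (simp add: cross_scaleR_left)
    then have nn: "\<alpha> \<ge> 0" "\<beta> > 0" using le s_eq(2,3) D by (auto simp: zero_less_mult_iff zero_le_mult_iff)
    have "surrounds Q1 s" using s(1) by (simp add: Q2_def peel_iff)
    then have "0 < cross (v0 - s) (v1 - s)" using edge_cross e by blast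
    also have "cross (v0 - s) (v1 - s) = cross (v1 - v0) (s - v0)" 
      using cross_edge_cone[of v1 v0 s s] by simp
    also have "\<dots> = D * (1 - \<alpha> - \<beta>)"
      using cross_edge_cone[of v1 v0 s z] s_eq(2,3) by (simp add: D_def algebra_simps)
    finally have ab: "\<alpha> + \<beta> < 1" using D by (simp add: zero_less_mult_iff)
    obtain k' where l': "k' > 0" "x0 - z = k' *\<^sub>R d" using r(1) by (auto simp: on_ray_def)
    define k where "k = k' / c"
    have l: "x0 - z = k *\<^sub>R (v0 - z)" "k > 0" using l' c by (simp_all add: k_def)
    have "v0 \<in> peel Q" using v(1) boundary_subset by (auto simp: Q1_def)
    then have l1: "k > 1" using boundary_beyond_peel[OF x(1) _ surrounds(1) l] by blast
    obtain a b where x1_eq: "x1 - z = a *\<^sub>R (v0 - z) + b *\<^sub>R (v1 - z)"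
      "cross (v0 - z) (x1 - z) = b * D" "cross (x1 - z) (v1 - z) = a * D"
      using cross_basis[of "v0 - z" "v1 - z" "x1 - z"] D unfolding D_def by (metis less_irrefl)
    have pos: "a > 0" "b > 0" using cone1 x1_eq(2,3) D by (auto simp: in_cone_def zero_less_mult_iff)
    have "cross (v1 - v0) (x1 - v0) < 0"
      using beyond_edge[OF e hull_inc[OF zQ] surrounds(2) _ cone1] boundary_not_in_hull_peel[OF x(2)]
      by (simp add: Q1_def)
    then have "D * (1 - a - b) < 0"
      using cross_edge_cone[of v1 v0 x1 z] x1_eq(2,3) by (simp add: D_def algebra_simps)
    then have sum: "a + b > 1" using D by (simp add: mult_less_0_iff)
    have eqs: "y - s = (y - z) - (\<alpha> *\<^sub>R (v0 - z) + \<beta> *\<^sub>R (v1 - z))" for y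
      using s_eq(1) by (simp add: algebra_simps)
    have cross0: "cross (v0 - z) (x0 - z) = 0" "cross (x0 - z) (v1 - z) = k * D"
      unfolding l(1) by (simp_all add: cross_scaleR_left cross_scaleR_right D_def)
    have "in_cone s v0 v1 x0"
    proof -
      have "cross (v0 - s) (x0 - s) = D * (\<beta> * (k - 1))"
        unfolding eqs cross_shift cross0 D_def[symmetric] by (simp add: algebra_simps)
      moreover have "cross (x0 - s) (v1 - s) = D * ((1 - \<beta>) * k - \<alpha>)"
        unfolding eqs cross_shift cross0 D_def[symmetric] by (simp add: algebra_simps)
      moreover have "\<alpha> < (1 - \<beta>) * k"
      proof -
        have "\<alpha> < (1 - \<beta>) * 1" using ab by simp
        also have "\<dots> < (1 - \<beta>) * k" using l1 ab nn by (intro mult_strict_left_mono) auto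
        finally show ?thesis .
      qed
      ultimately show ?thesis using D nn l1 by (simp add: in_cone_def)
    qed
    moreover have "in_cone s v0 v1 x1"
    proof -
      have 1: "cross (v0 - s) (x1 - s) = D * ((1 - \<alpha>) * b + \<beta> * (a - 1))"
        unfolding eqs cross_shift x1_eq(2,3) D_def[symmetric] by (simp add: algebra_simps)
      have 2: "cross (x1 - s) (v1 - s) = D * ((1 - \<beta>) * a + \<alpha> * (b - 1))"
        unfolding eqs cross_shift x1_eq(2,3) D_def[symmetric] by (simp add: algebra_simps)
      have "\<beta> * (a - 1) \<ge> \<beta> * (- b)" "\<alpha> * (b - 1) \<ge> \<alpha> * (- a)"
        using nn sum by (intro mult_left_mono; simp)+
      moreover have "(1 - \<alpha> - \<beta>) * b > 0" "(1 - \<alpha> - \<beta>) * a > 0" using ab pos by simp_all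
      ultimately have "(1 - \<alpha>) * b + \<beta> * (a - 1) > 0" "(1 - \<beta>) * a + \<alpha> * (b - 1) > 0"
        by (simp_all add: algebra_simps)
      with D 1 2 show ?thesis by (simp add: in_cone_def)
    qed
    moreover have "x0 \<noteq> x1" using c1(1) l'(2) by (auto simp: cross_scaleR_right)
    ultimately show False
      using sector[OF P(1,2), of v0 v1 s x0 x1] e s(1) x P(3) by (auto simp: Q1_def Q2_def)
  qed
  have "\<exists>s0\<in>boundary Q2. on_ray z d s0"
  proof (rule ccontr)
    assume none: "\<not> (\<exists>s0\<in>boundary Q2. on_ray z d s0)"
    \<comment> \<open>\<open>t\<close> is the last point of the third layer before the ray and
      \<open>s\<close> its successor, so a ray that misses the layer falls strictly between
      them.\<close>
    obtain t where t: "t \<in> boundary Q2" "0 < cross (t - z) d"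
      "\<And>w. w \<in> boundary Q2 \<Longrightarrow> 0 < cross (w - z) d \<Longrightarrow> \<not> 0 < cross (t - z) (w - z)"
      using prev_exists[OF finite_boundary[OF f(2)] surrounds_boundary[OF f(2) surrounds(3)] d0] by blast
    define s where "s = next_point Q2 z t"
    have s: "s \<in> boundary Q2" "angular_next (boundary Q2) z (t - z) s" "edge Q2 t s"
      using next_point[OF f(2) surrounds(3) t(1)] by (auto simp: s_def)
    have ts: "0 < cross (t - z) (s - z)" using s(2) by (simp add: angular_next_def)
    have ds: "0 < cross d (s - z)"
    proof (rule ccontr)
      assume "\<not> 0 < cross d (s - z)"
      moreover have "\<not> 0 < cross (s - z) d" using t(3)[OF s(1)] ts by blast
      ultimately have "cross d (s - z) = 0" using cross_commute[of "s - z" d] by linarith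
      then obtain k where "k > 0" "s - z = k *\<^sub>R d"
        using parallel_in_half_plane[OF t(2) ts] by blast
      with none s(1) show False by (auto simp: on_ray_def)
    qed
    have vs: "0 < cross (v1 - z) (s - z)" using no_early[OF _ ds] s(1) boundary_subset by blast
    \<comment> \<open>Three-term Pluecker relation for the directions of \<open>t\<close>,
      \<open>d\<close>, \<open>v1\<close> and \<open>s\<close>. It yields that \<open>v1\<close> is
      reached from \<open>t\<close> by less than a half turn.\<close>
    have "cross (t - z) (v1 - z) * cross d (s - z) =
      cross (t - z) d * cross (v1 - z) (s - z) + cross (t - z) (s - z) * cross d (v1 - z)"
      by (simp add: cross_def algebra_simps)
    also have "\<dots> > 0" using t(2) vs ts angular_next by (simp add: angular_next_def add_pos_pos)
    finally have "0 < cross (t - z) (v1 - z)" using ds by (simp add: zero_less_mult_iff)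
    then have "in_cone z t s v1" using vs by (simp add: in_cone_def)
    moreover have "in_cone z t s v0"
      using t(2) ds c by (simp add: in_cone_def cross_scaleR_left cross_scaleR_right)
    moreover have "v0 \<noteq> v1" using e by (simp add: edge_def)
    ultimately show False
      using sector[OF P(1) cl, of t s z v0 v1] s(3) z v P(3) by (auto simp: Q1_def Q2_def)
  qed
  then obtain s0 where s0: "s0 \<in> boundary Q2" "on_ray z d s0" by blast
  obtain s1 where s1: "s1 \<in> boundary Q2" "angular_next (boundary Q2) z d s1"
    using next_exists[OF finite_boundary[OF f(2)] surrounds_boundary[OF f(2) surrounds(3)] d0] by blast
  then have "0 < cross (v1 - z) (s1 - z)"
    using no_early[of s1] boundary_subset by (auto simp: angular_next_def)
  moreover have "0 < cross d (v1 - z)" using angular_next by (simp add: angular_next_def)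
  ultimately show ?thesis
    unfolding lead_def using v r(2) s0 s1 by (auto simp: Q1_def Q2_def)
qed

text \<open>A \<open>lead\<close> involves two layers at once: each induction step peels one layer
  off, and the base case supplies the last two indices, \<open>m\<close> and
  \<open>m + 1\<close>.\<close>

lemma lead_funpow:
  assumes "finite P" "hull_closed P Q" "\<nexists>H. five_hole P H" "z \<in> (peel ^^ (m + 2)) Q" "lead Q z d"
  shows "i \<le> m + 1 \<Longrightarrow> \<exists>p\<in>boundary ((peel ^^ i) Q). on_ray z d p"
  using assms
proof (induction m arbitrary: Q i)
  case 0
  then have "i = 0 \<or> i = 1" by auto
  then show ?case using 0(6) by (auto simp: lead_def)
next
  case (Suc m)
  show ?case
  proof (cases i)
    case 0
    then show ?thesis using Suc.prems(6) by (auto simp: lead_def)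
  next
    case (Suc j)
    have eq: "(peel ^^ Suc n) Q = (peel ^^ n) (peel Q)" for n by (simp only: funpow_Suc_right o_apply)
    have zm: "z \<in> (peel ^^ (m + 2)) (peel Q)" using Suc.prems(5) eq[of "m + 2"] by simp
    have "(peel ^^ (m + 2)) (peel Q) = (peel ^^ m) (peel (peel (peel Q)))"
      by (simp add: funpow_swap1)
    moreover have "(peel ^^ n) R \<subseteq> R" for n R
      by (induction n) (use peel_subset in auto)
    ultimately have "z \<in> peel (peel (peel Q))" using zm by blast
    then have "lead (peel Q) z d" using lead_step Suc.prems(2,3,4,6) by blast
    then show ?thesis
      using Suc.IH[OF _ Suc.prems(2) hull_closed_peel[OF Suc.prems(3)] Suc.prems(4) zm, of j]
        Suc.prems(1) Suc eq[of j] by auto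
  qed
qed

section \<open>The number of layers\<close>

lemma perp_decomposition:
  fixes a w :: point
  shows "(a \<bullet> a) *\<^sub>R w = (a \<bullet> w) *\<^sub>R a + (perp a \<bullet> w) *\<^sub>R perp a"
  by (simp add: vec_eq_iff forall_2 perp_def inner_vec_def sum_2 algebra_simps)

lemma line_coordinate:
  fixes a p x y :: point
  assumes "a \<noteq> 0" "a \<bullet> x = a \<bullet> p" "a \<bullet> y = a \<bullet> p" "perp a \<bullet> y \<noteq> perp a \<bullet> p"
  shows "x - p = ((perp a \<bullet> x - perp a \<bullet> p) / (perp a \<bullet> y - perp a \<bullet> p)) *\<^sub>R (y - p)"
proof -
  have "(a \<bullet> a) *\<^sub>R (x - p) = (perp a \<bullet> x - perp a \<bullet> p) *\<^sub>R perp a"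
    and y: "(a \<bullet> a) *\<^sub>R (y - p) = (perp a \<bullet> y - perp a \<bullet> p) *\<^sub>R perp a"
    using perp_decomposition[of a "x - p"] perp_decomposition[of a "y - p"] assms(2,3)
    by (simp_all add: inner_diff_right)
  moreover have "perp a = ((a \<bullet> a) / (perp a \<bullet> y - perp a \<bullet> p)) *\<^sub>R (y - p)"
    using arg_cong[OF y, of "\<lambda>u. (1 / (perp a \<bullet> y - perp a \<bullet> p)) *\<^sub>R u"] assms(4) by simp
  ultimately have "(a \<bullet> a) *\<^sub>R (x - p) = (a \<bullet> a) *\<^sub>R
    (((perp a \<bullet> x - perp a \<bullet> p) / (perp a \<bullet> y - perp a \<bullet> p)) *\<^sub>R (y - p))"
    by (metis (no_types, lifting) mult.commute scaleR_scaleR times_divide_eq_right)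
  then show ?thesis using assms(1) by (simp only: scaleR_cancel_left) simp
qed

lemma line_coordinate_eq:
  fixes a p x :: point
  assumes "a \<noteq> 0" "a \<bullet> x = a \<bullet> p" "perp a \<bullet> x = perp a \<bullet> p"
  shows "x = p"
  using perp_decomposition[of a "x - p"] assms by (simp add: inner_diff_right)

text \<open>A further point \<open>p\<close> of \<open>P\<close> in the pentagon is on a supporting
  line of \<open>S\<close>. Exactly one vertex \<open>x\<close> on that line lies on the positive
  side of \<open>p\<close>; replacing \<open>x\<close> by \<open>p\<close> keeps strict convexity
  and expels \<open>x\<close>.\<close>

lemma five_strict_hole:
  assumes fin: "finite P" and cl: "hull_closed P S" and S: "boundary S = S"
    and X: "X \<subseteq> S" "card X = 5" "\<And>x. x \<in> X \<Longrightarrow> x \<notin> convex hull (X - {x})"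
  shows "\<exists>H. five_hole P H"
  using X
proof (induction "card (P \<inter> convex hull X)" arbitrary: X rule: less_induct)
  case less
  note X = less.prems
  have finX: "finite X" using X(2) card.infinite by fastforce
  have XP: "X \<subseteq> P" using X(1) cl by (auto simp: hull_closed_def)
  show ?case
  proof (cases "P \<inter> convex hull X \<subseteq> X")
    case True
    with five_holeI[OF XP X(2,3)] show ?thesis by blast
  next
    case False
    then obtain p where p: "p \<in> P" "p \<in> convex hull X" "p \<notin> X" by blast
    have "p \<in> boundary S" using p(1,2) hull_mono[OF X(1), of convex] cl S by (auto simp: hull_closed_def)
    then obtain a where a: "a \<noteq> 0" "\<And>q. q \<in> S \<Longrightarrow> a \<bullet> q \<le> a \<bullet> p" by (auto simp: boundary_def)
    define T where "T = X \<inter> {x. a \<bullet> x = a \<bullet> p}"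
    have face: "p \<in> convex hull (Y \<inter> {x. a \<bullet> x = a \<bullet> p})" if "Y \<subseteq> X" "p \<in> convex hull Y" for Y
      using that a X(1) finX by (intro convex_hull_face) (auto intro: finite_subset)
    let ?g = "\<lambda>x. perp a \<bullet> x"
    have neq: "?g x \<noteq> ?g p" if "x \<in> T" for x
      using line_coordinate_eq[OF a(1), of x p] that p(3) by (auto simp: T_def)
    have "\<exists>x\<in>T. ?g x > ?g p"
    proof (rule ccontr)
      assume "\<not> (\<exists>x\<in>T. ?g x > ?g p)"
      then have "?g x < ?g p" if "x \<in> T" for x using neq[OF that] that by force
      then have "?g p < ?g p"
        using face[OF order.refl p(2)] inner_less_convex_hull[of T "perp a" "?g p" p]
        by (auto simp: T_def)
      then show False by simp
    qed
    then obtain x where x: "x \<in> T" "?g x > ?g p" by blast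
    have xX: "x \<in> X" using x(1) by (simp add: T_def)
    have stays: "y \<notin> convex hull (insert p (X - {y}))" if "y \<in> X" for y
      using anti_exchange[OF X(3)[OF that], of p] p that by (metis insert_Diff)
    \<comment> \<open>Of two vertices on the same side of \<open>p\<close>, the nearer one would be
      between \<open>p\<close> and the other one, against anti-exchange.\<close>
    have uniq: "?g y < ?g p" if y: "y \<in> T" "y \<noteq> x" for y
    proof (rule ccontr)
      assume "\<not> ?g y < ?g p"
      with neq[OF y(1)] have gy: "?g y > ?g p" by simp
      have no: False
        if "u \<in> T" "w \<in> T" "u \<noteq> w" "?g p < ?g u" "?g u \<le> ?g w" for u w
      proof -
        define c where "c = (?g u - ?g p) / (?g w - ?g p)"
        have "u - p = c *\<^sub>R (w - p)"
          unfolding c_def using that a(1) by (intro line_coordinate) (auto simp: T_def)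
        then have "u = (1 - c) *\<^sub>R p + c *\<^sub>R w" by (simp add: algebra_simps)
        moreover have "0 \<le> c" "c \<le> 1" using that(4,5) by (auto simp: c_def)
        ultimately have "u \<in> closed_segment p w" by (auto simp: closed_segment_def)
        also have "\<dots> \<subseteq> convex hull (insert p (X - {u}))"
          unfolding segment_convex_hull using that by (intro hull_mono) (auto simp: T_def)
        finally show False using stays[of u] that(1) by (auto simp: T_def)
      qed
      show False using no[of x y] no[of y x] x y gy by (cases "?g x \<le> ?g y") auto
    qed
    have pX: "p \<notin> convex hull (X - {x})"
    proof
      assume "p \<in> convex hull (X - {x})"
      then have "p \<in> convex hull ((X - {x}) \<inter> {x. a \<bullet> x = a \<bullet> p})" using face by blast
      then have "?g p < ?g p"
        by (rule inner_less_convex_hull[rotated]) (use uniq in \<open>auto simp: T_def\<close>)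
      then show False by simp
    qed
    let ?Y = "insert p (X - {x})"
    have "y \<notin> convex hull (?Y - {y})" if "y \<in> ?Y" for y
    proof (cases "y = p")
      case True
      then have "?Y - {y} = X - {x}" using p(3) by auto
      then show ?thesis using pX True by simp
    next
      case False
      then have "y \<in> X" "?Y - {y} \<subseteq> insert p (X - {y})" using that by auto
      then show ?thesis using stays hull_mono by blast
    qed
    moreover have "?Y \<subseteq> S" using X(1) \<open>p \<in> boundary S\<close> S by auto
    moreover have "card ?Y = 5" using finX xX p(3) X(2) by simp
    moreover have "card (P \<inter> convex hull ?Y) < card (P \<inter> convex hull X)"
    proof (intro psubset_card_mono)
      have "?Y \<subseteq> convex hull X" using p(2) hull_subset[of X convex] by auto
      then have "convex hull ?Y \<subseteq> convex hull X" by (meson convex_convex_hull hull_minimal)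
      moreover have "x \<in> P" "x \<in> convex hull X" using xX XP by (auto intro: hull_inc)
      ultimately show "P \<inter> convex hull ?Y \<subset> P \<inter> convex hull X" using stays[OF xX] by blast
    qed (use fin in auto)
    ultimately show ?thesis using less.hyps by blast
  qed
qed

text \<open>A generating subset of least size serves as the vertex set, since a redundant element
  could be dropped.\<close>

lemma strictly_convex_generators:
  fixes S :: "'a::euclidean_space set"
  assumes "finite S"
  obtains E where "E \<subseteq> S" "S \<subseteq> convex hull E" "\<And>e. e \<in> E \<Longrightarrow> e \<notin> convex hull (E - {e})"
proof -
  let ?Q = "\<lambda>E. E \<subseteq> S \<and> S \<subseteq> convex hull E"
  have "?Q S" by (simp add: hull_subset)
  then obtain E where E: "?Q E" "\<And>E'. ?Q E' \<Longrightarrow> card E \<le> card E'"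
    using ex_has_least_nat[of ?Q S card] by blast
  have "e \<notin> convex hull (E - {e})" if e: "e \<in> E" for e
  proof
    assume "e \<in> convex hull (E - {e})"
    then have "E \<subseteq> convex hull (E - {e})" using hull_subset[of "E - {e}" convex] by blast
    then have "convex hull E \<subseteq> convex hull (E - {e})" by (meson convex_convex_hull hull_minimal)
    then have "card E \<le> card (E - {e})" using E(1) by (intro E(2)) blast
    moreover have "finite E" using E(1) assms finite_subset by blast
    ultimately show False using e by (metis card_Diff1_less not_le)
  qed
  with E(1) that show ?thesis by blast
qed

lemma choose_2_le_6: "n \<le> 4 \<Longrightarrow> n choose 2 \<le> 6"
proof -
  assume "n \<le> 4"
  then have "n = 0 \<or> n = 1 \<or> n = 2 \<or> n = 3 \<or> n = 4" by arith
  then show ?thesis by (auto simp: choose_two)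
qed

text \<open>There are at most four vertices, as five would yield a hole. Any other point has a
  supporting line, which passes through two vertices. The at most six lines through two vertices
  carry at most \<open>l - 1\<close> points each, hence at most \<open>l - 3\<close> besides the two
  vertices.\<close>

lemma empty_layer_bound:
  assumes fin: "finite P" and nohole: "\<nexists>H. five_hole P H" and l: "3 \<le> l"
    and nocol: "\<And>X. X \<subseteq> P \<Longrightarrow> collinear X \<Longrightarrow> card X < l"
    and cl: "hull_closed P S" and S: "boundary S = S"
  shows "card S \<le> 4 + 6 * (l - 3)"
proof -
  have finS: "finite S" and SP: "S \<subseteq> P" using fin cl finite_subset by (auto simp: hull_closed_def)
  obtain E where E: "E \<subseteq> S" "S \<subseteq> convex hull E" "\<And>e. e \<in> E \<Longrightarrow> e \<notin> convex hull (E - {e})"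
    using strictly_convex_generators[OF finS] by blast
  have finE: "finite E" using E(1) finS finite_subset by blast
  have E4: "card E \<le> 4"
  proof (rule ccontr)
    assume "\<not> card E \<le> 4"
    then obtain X where X: "X \<subseteq> E" "card X = 5"
      using obtain_subset_with_card_n[of 5 E] by auto
    have "x \<notin> convex hull (X - {x})" if "x \<in> X" for x
      using E(3)[of x] hull_mono[of "X - {x}" "E - {x}" convex] X(1) that by blast
    then show False using five_strict_hole[OF fin cl S, of X] X E(1) nohole by blast
  qed
  define \<D> where "\<D> = {D. D \<subseteq> E \<and> card D = 2}"
  let ?G = "\<lambda>D. S \<inter> affine hull D - D"
  have card\<D>: "card \<D> \<le> 6"
    using n_subsets[OF finE, of 2] choose_2_le_6[OF E4] by (simp add: \<D>_def)
  have fin\<D>: "finite \<D>" using finE by (simp add: \<D>_def)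
  have G: "card (?G D) \<le> l - 3" if D: "D \<in> \<D>" for D
  proof -
    have DS: "D \<subseteq> S" "card D = 2" using D E(1) by (auto simp: \<D>_def)
    then obtain e e' where "D = {e, e'}" by (meson card_2_iff)
    then have "collinear (S \<inter> affine hull D)"
      by (metis collinear_2 collinear_affine_hull_collinear collinear_subset inf_le2)
    then have "card (S \<inter> affine hull D) < l" using SP by (intro nocol) auto
    moreover have "D \<subseteq> S \<inter> affine hull D" using DS(1) hull_subset[of D affine] by simp
    moreover have "finite D" using DS(1) finS finite_subset by blast
    ultimately show ?thesis using DS(2) by (simp add: card_Diff_subset)
  qed
  have "S \<subseteq> E \<union> (\<Union>D\<in>\<D>. ?G D)"
  proof
    fix s assume s: "s \<in> S"
    show "s \<in> E \<union> (\<Union>D\<in>\<D>. ?G D)"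
    proof (cases "s \<in> E")
      case False
      obtain a where a: "a \<noteq> 0" "\<And>q. q \<in> S \<Longrightarrow> a \<bullet> q \<le> a \<bullet> s"
        using s S by (force simp: boundary_def)
      define T where "T = E \<inter> {x. a \<bullet> x = a \<bullet> s}"
      have sT: "s \<in> convex hull T"
        unfolding T_def using s E(1,2) a(2) finE by (intro convex_hull_face) auto
      then obtain e where e: "e \<in> T" by fastforce
      have "\<not> T \<subseteq> {e}"
      proof
        assume "T \<subseteq> {e}"
        then have "s \<in> convex hull {e}" using sT by (meson hull_mono subsetD)
        then show False using False e by (simp add: T_def)
      qed
      then obtain e' where e': "e' \<in> T" "e' \<noteq> e" by blast
      have "perp a \<bullet> e' \<noteq> perp a \<bullet> e"
        using line_coordinate_eq[OF a(1), of e' e] e e' by (auto simp: T_def)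
      then obtain c where "s - e = c *\<^sub>R (e' - e)"
        using line_coordinate[OF a(1), of s e e'] e e' by (auto simp: T_def)
      then have "s = (1 - c) *\<^sub>R e + c *\<^sub>R e'" by (simp add: algebra_simps)
      then have "s \<in> affine hull {e, e'}"
        unfolding affine_hull_2 by (intro CollectI exI[of _ "1 - c"] exI[of _ c]) auto
      moreover have "{e, e'} \<in> \<D>" using e e' by (auto simp: \<D>_def T_def)
      moreover have "s \<notin> {e, e'}" using False e e' by (auto simp: T_def)
      ultimately show ?thesis using s by blast
    qed simp
  qed
  then have "card S \<le> card (E \<union> (\<Union>D\<in>\<D>. ?G D))"
    using finE fin\<D> finS by (intro card_mono) auto
  also have "\<dots> \<le> card E + card (\<Union>D\<in>\<D>. ?G D)" by (rule card_Un_le)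
  also have "card (\<Union>D\<in>\<D>. ?G D) \<le> (\<Sum>D\<in>\<D>. card (?G D))" using fin\<D> by (rule card_UN_le)
  also have "\<dots> \<le> (\<Sum>D\<in>\<D>. l - 3)" using G by (intro sum_mono) auto
  also have "\<dots> \<le> 6 * (l - 3)" using card\<D> by simp
  finally show ?thesis using E4 by simp
qed

text \<open>No point of \<open>P\<close> is left as a deep apex. If the hull of the inner layer has
  interior, any point there cuts the outer layer into cones, each with at most one point on its ray
  and a hull-closed set of at most \<open>N\<close> points in its open part. Otherwise a line
  through the inner layer cuts the outer one into two such sets and a collinear set.\<close>

lemma last_layers_bound:
  assumes fin: "finite P" and nohole: "\<nexists>H. five_hole P H" and l: "3 \<le> l"
    and nocol: "\<And>X. X \<subseteq> P \<Longrightarrow> collinear X \<Longrightarrow> card X < l"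
    and cl: "hull_closed P Q" and inn2: "peel (peel Q) = {}"
  defines "N \<equiv> 4 + 6 * (l - 3)"
  shows "card (boundary Q) \<le> N * (N + 1)"
proof -
  have finQ: "finite Q" using fin cl finite_subset by (auto simp: hull_closed_def)
  have f: "finite (peel Q)" "finite (boundary Q)" using finQ by (simp_all add: finite_boundary finite_peel)
  have bdI: "boundary (peel Q) = peel Q" using inn2 boundary_subset[of "peel Q"] by (auto simp: peel_def)
  have cI: "card (boundary (peel Q)) \<le> N"
    using empty_layer_bound[OF fin nohole l nocol hull_closed_peel[OF cl] bdI] by (simp add: bdI N_def)
  have piece: "card S \<le> N"
    if S: "S \<subseteq> boundary Q" "\<And>p. p \<in> boundary Q \<Longrightarrow> p \<in> convex hull S \<Longrightarrow> p \<in> S"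
      "\<And>p. p \<in> convex hull S \<Longrightarrow> p \<notin> peel Q" for S
  proof -
    have "convex hull S \<subseteq> convex hull Q" using S(1) boundary_subset by (intro hull_mono) blast
    then have "hull_closed P S"
      using cl S boundary_subset[of Q] unfolding hull_closed_def peel_def by blast
    then show ?thesis unfolding N_def
      using empty_layer_bound[OF fin nohole l nocol _ boundary_boundary_subset[OF S(1)]] by blast
  qed
  have lN: "l \<le> N" using l by (simp add: N_def)
  show ?thesis
  proof (cases "interior (convex hull (peel Q)) = {}")
    case False
    then obtain z where z: "z \<in> interior (convex hull (peel Q))" by blast
    have zs: "surrounds (peel Q) z"
      unfolding surrounds_def
    proof (intro allI impI, rule ccontr)
      fix a :: point assume a: "a \<noteq> 0" "\<not> (\<exists>q\<in>peel Q. a \<bullet> z < a \<bullet> q)"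
      have "convex hull (peel Q) \<subseteq> {x. a \<bullet> x \<le> a \<bullet> z}"
        using a(2) by (intro hull_minimal) (auto simp: convex_halfspace_le not_less)
      then have "z \<in> interior {x. a \<bullet> x \<le> a \<bullet> z}" using z interior_mono by blast
      then show False using a(1) by (simp add: interior_halfspace_le)
    qed
    have zQ: "surrounds Q z" using surrounds_mono[OF zs peel_subset] .
    have "card (boundary Q) \<le> (N + 1) * card (boundary (peel Q))"
    proof (rule half_cone_count[OF f zs zQ order.refl])
      fix v assume v: "v \<in> boundary (peel Q)"
      let ?v' = "next_point (peel Q) z v"
      let ?S = "{x\<in>boundary Q. in_cone z v ?v' x}"
      have e: "edge (peel Q) v ?v'" using next_point(3)[OF f(1) zs v] .
      have cone: "convex hull ?S \<subseteq> {x. in_cone z v ?v' x}"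
        by (intro hull_minimal in_cone_convex) auto
      have cS: "card ?S \<le> N"
      proof (rule piece)
        fix p assume p: "p \<in> convex hull ?S"
        have "cross (?v' - v) (x - v) < 0" if "x \<in> ?S" for x
          using beyond_edge[OF e _ zs] boundary_not_in_hull_peel z interior_subset that by blast
        then have "perp (?v' - v) \<bullet> p < perp (?v' - v) \<bullet> v"
          by (intro inner_less_convex_hull[OF _ p]) (simp add: perp_less_iff)
        then show "p \<notin> peel Q" using e by (auto simp: edge_def perp_less_iff)
      qed (use cone in auto)
      have eq: "{x\<in>boundary Q. on_ray z (v - z) x \<or> in_cone z v ?v' x} = {x\<in>boundary Q. on_ray z (v - z) x} \<union> ?S"
        by auto
      show "card {x\<in>boundary Q. on_ray z (v - z) x \<or> in_cone z v ?v' x} \<le> N + 1"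
        unfolding eq using order.trans[OF card_Un_le add_mono[OF on_ray_card[OF f(2) zQ order.refl] cS]]
        by (simp only: add.commute)
    qed
    also have "\<dots> \<le> (N + 1) * N" using cI by (intro mult_left_mono) auto
    finally show ?thesis by (simp add: mult.commute)
  next
    case True
    obtain a b where ab: "a \<noteq> 0" "convex hull (peel Q) \<subseteq> {x. a \<bullet> x = b}"
      using empty_interior_subset_hyperplane[OF convex_convex_hull True] by blast
    have I: "a \<bullet> q = b" if "q \<in> peel Q" for q using ab(2) hull_inc[OF that, of convex] by auto
    define L M R where "L = {x\<in>boundary Q. a \<bullet> x < b}" and "M = {x\<in>boundary Q. a \<bullet> x = b}"
      and "R = {x\<in>boundary Q. - a \<bullet> x < - b}"
    have half: "card {x\<in>boundary Q. a' \<bullet> x < b'} \<le> N" if "\<And>q. q \<in> peel Q \<Longrightarrow> a' \<bullet> q = b'" for a' b'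
    proof (rule piece)
      fix p assume "p \<in> convex hull {x\<in>boundary Q. a' \<bullet> x < b'}"
      then have less: "a' \<bullet> p < b'" by (rule inner_less_convex_hull[rotated]) auto
      then show "p \<notin> peel Q" using that by force
      show "p \<in> {x\<in>boundary Q. a' \<bullet> x < b'}" if "p \<in> boundary Q" using less that by blast
    qed auto
    have "card L \<le> N" "card R \<le> N" unfolding L_def R_def using I by (intro half; simp)+
    moreover have "card M < l"
    proof (rule nocol)
      show "M \<subseteq> P" using cl boundary_subset by (auto simp: M_def hull_closed_def)
      show "collinear M"
        unfolding collinear_def
      proof (intro exI[of _ "perp a"] ballI)
        fix x y assume "x \<in> M" "y \<in> M"
        then have eq: "(a \<bullet> a) *\<^sub>R (x - y) = (perp a \<bullet> (x - y)) *\<^sub>R perp a"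
          using perp_decomposition[of a "x - y"] by (simp add: M_def inner_diff_right)
        have "x - y = (1 / (a \<bullet> a)) *\<^sub>R ((a \<bullet> a) *\<^sub>R (x - y))" using ab(1) by simp
        also have "\<dots> = ((perp a \<bullet> (x - y)) / (a \<bullet> a)) *\<^sub>R perp a" unfolding eq by simp
        finally have "x - y = ((perp a \<bullet> (x - y)) / (a \<bullet> a)) *\<^sub>R perp a" .
        then show "\<exists>c. x - y = c *\<^sub>R perp a" ..
      qed
    qed
    moreover have "boundary Q = L \<union> M \<union> R" by (auto simp: L_def M_def R_def)
    then have "card (boundary Q) \<le> card L + card M + card R"
      using card_Un_le[of "L \<union> M" R] card_Un_le[of L M] by simp
    ultimately have "card (boundary Q) \<le> 3 * N" using lN by linarith
    also have "3 * N \<le> (N + 1) * N" by (intro mult_right_mono) (auto simp: N_def)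
    also have "\<dots> = N * (N + 1)" by (rule mult.commute)
    finally show ?thesis .
  qed
qed

text \<open>The size at most doubles per layer until two layers remain. Truncated subtraction in
  \<open>j - 2\<close> makes the formula right for one or two layers as well.\<close>

lemma layers_bound:
  assumes fin: "finite P" and nohole: "\<nexists>H. five_hole P H" and l: "3 \<le> l"
    and nocol: "\<And>X. X \<subseteq> P \<Longrightarrow> collinear X \<Longrightarrow> card X < l"
  defines "N \<equiv> 4 + 6 * (l - 3)"
  shows "hull_closed P Q \<Longrightarrow> (peel ^^ j) Q = {} \<Longrightarrow> card (boundary Q) \<le> 2 ^ (j - 2) * (N * (N + 1))"
proof (induction j arbitrary: Q)
  case 0
  then show ?case using boundary_subset[of Q] by simp
next
  case (Suc j)
  have cl: "hull_closed P (peel Q)" using Suc.prems(1) by (rule hull_closed_peel)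
  have empty: "(peel ^^ j) (peel Q) = {}" using Suc.prems(2) by (simp add: funpow_swap1)
  show ?case
  proof (cases "peel (peel Q) = {}")
    case True
    have "card (boundary Q) \<le> N * (N + 1)"
      using last_layers_bound[OF fin nohole l nocol Suc.prems(1) True] by (simp add: N_def)
    also have "\<dots> \<le> 2 ^ (Suc j - 2) * (N * (N + 1))" by simp
    finally show ?thesis .
  next
    case False
    have "j \<noteq> 0" "j \<noteq> 1" using empty False peel_subset[of "peel Q"] by (auto simp: numeral_2_eq_2)
    then have j: "Suc j - 2 = Suc (j - 2)" by simp
    have "card (boundary Q) \<le> 2 * card (boundary (peel Q))"
      using layer_ratio[OF fin Suc.prems(1) nohole False] .
    also have "\<dots> \<le> 2 * (2 ^ (j - 2) * (N * (N + 1)))" using Suc.IH[OF cl empty] by simp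
    finally show ?thesis unfolding j by simp
  qed
qed

section \<open>Erdos--Szekeres numbers of sets with collinearities\<close>

text \<open>If the hull has interior, a functional separating \<open>v\<close> from this interior
  also bounds its closure; otherwise the hull lies in a line, whose normal supports it at every
  point.\<close>

lemma convex_position_iff:
  assumes "finite X"
  shows "convex_position X \<longleftrightarrow> boundary X = X"
proof -
  have "v \<in> frontier (convex hull X) \<longleftrightarrow> (\<exists>a. a \<noteq> 0 \<and> (\<forall>x\<in>X. a \<bullet> x \<le> a \<bullet> v))" if v: "v \<in> X" for v
  proof
    assume "\<exists>a. a \<noteq> 0 \<and> (\<forall>x\<in>X. a \<bullet> x \<le> a \<bullet> v)"
    then obtain a where a: "a \<noteq> 0" "\<forall>x\<in>X. a \<bullet> x \<le> a \<bullet> v" by blast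
    have "convex hull X \<subseteq> {x. a \<bullet> x \<le> a \<bullet> v}"
      using a(2) by (intro hull_minimal) (auto simp: convex_halfspace_le)
    then have "interior (convex hull X) \<subseteq> {x. a \<bullet> x < a \<bullet> v}"
      using interior_mono interior_halfspace_le[OF a(1)] by metis
    moreover have "v \<in> closure (convex hull X)" using closure_subset hull_inc[OF v] by (rule subsetD)
    ultimately show "v \<in> frontier (convex hull X)" by (auto simp: frontier_def)
  next
    assume fr: "v \<in> frontier (convex hull X)"
    let ?I = "interior (convex hull X)"
    have vI: "v \<notin> ?I" using fr by (simp add: frontier_def)
    show "\<exists>a. a \<noteq> 0 \<and> (\<forall>x\<in>X. a \<bullet> x \<le> a \<bullet> v)"
    proof (cases "?I = {}")
      case True
      obtain a b where a: "a \<noteq> 0" "convex hull X \<subseteq> {x. a \<bullet> x = b}"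
        using empty_interior_subset_hyperplane[OF convex_convex_hull True] by blast
      then have "a \<bullet> x = b" if "x \<in> X" for x using that hull_inc[of x X convex] by auto
      with a(1) v show ?thesis by (intro exI[of _ a]) auto
    next
      case False
      obtain a b where a: "a \<noteq> 0" "a \<bullet> v \<le> b" "\<forall>x\<in>?I. b \<le> a \<bullet> x"
        using separating_hyperplane_sets[of "{v}" ?I] False vI
        by (auto simp: convex_interior)
      have "closure ?I \<subseteq> {x. a \<bullet> v \<le> a \<bullet> x}"
        using a by (intro closure_minimal) (auto simp: closed_halfspace_ge intro: order.trans)
      moreover have "X \<subseteq> closure ?I"
        using convex_closure_interior[OF convex_convex_hull False]
          hull_subset[of X convex] closure_subset[of "convex hull X"] by blast
      ultimately show ?thesis using a(1) by (intro exI[of _ "- a"]) auto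
    qed
  qed
  then show ?thesis by (auto simp: convex_position_def boundary_def)
qed

section \<open>Existence of Erdos--Szekeres numbers\<close>

lemma collinear_iff_cross:
  assumes "q \<noteq> p"
  shows "collinear {q, p, r} \<longleftrightarrow> cross (q - p) (r - p) = 0"
proof
  assume "collinear {q, p, r}"
  then show "cross (q - p) (r - p) = 0"
    using assms by (auto simp: collinear_3[of q p r] collinear_lemma cross_scaleR_right)
next
  assume c: "cross (q - p) (r - p) = 0"
  have q: "(q - p) \<bullet> (q - p) \<noteq> 0" using assms by simp
  have "((q - p) \<bullet> (q - p)) *\<^sub>R (r - p) = ((q - p) \<bullet> (r - p)) *\<^sub>R (q - p)"
    using perp_decomposition[of "q - p" "r - p"] c by (simp add: inner_perp)
  then have "(1 / ((q - p) \<bullet> (q - p))) *\<^sub>R (((q - p) \<bullet> (q - p)) *\<^sub>R (r - p)) =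
    (1 / ((q - p) \<bullet> (q - p))) *\<^sub>R (((q - p) \<bullet> (r - p)) *\<^sub>R (q - p))" by simp
  then have "r - p = (((q - p) \<bullet> (r - p)) / ((q - p) \<bullet> (q - p))) *\<^sub>R (q - p)"
    using q by simp
  then show "collinear {q, p, r}"
    by (auto simp: collinear_3[of q p r] collinear_lemma)
qed

text \<open>Erdos--Szekeres via Ramsey's theorem for triples: points whose ordered triples all have the
  same orientation are in convex position, the line through two successive points being
  supporting.\<close>

lemma boundary_same_orientation:
  fixes f :: "nat \<Rightarrow> point"
  assumes H: "finite H" "3 \<le> card H" and inj: "inj_on f H" and e: "e \<noteq> 0"
    and orient: "\<And>i j m. i \<in> H \<Longrightarrow> j \<in> H \<Longrightarrow> m \<in> H \<Longrightarrow> i < j \<Longrightarrow> j < m \<Longrightarrow>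
      0 < e * cross (f j - f i) (f m - f i)"
  shows "boundary (f ` H) = f ` H"
proof
  show "boundary (f ` H) \<subseteq> f ` H" by (rule boundary_subset)
  show "f ` H \<subseteq> boundary (f ` H)"
  proof
    fix v assume "v \<in> f ` H"
    then obtain i where i: "i \<in> H" "v = f i" by blast
    have support: "f u \<in> boundary (f ` H) \<and> f w \<in> boundary (f ` H)"
      if uw: "u \<in> H" "w \<in> H" "u < w" and none: "\<And>m. m \<in> H \<Longrightarrow> \<not> (u < m \<and> m < w)" for u w
    proof -
      have pos: "0 \<le> e * cross (f w - f u) (f m - f u)" if m: "m \<in> H" for m
      proof -
        consider "m = u" | "m = w" | "m < u" | "w < m" using none[OF m] by linarith
        then show ?thesis
        proof cases
          case 3
          have "cross (f w - f u) (f m - f u) = cross (f u - f m) (f w - f m)"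
            by (simp add: cross_def algebra_simps)
          then show ?thesis using orient[OF m uw(1,2) 3 uw(3)] by simp
        next
          case 4
          then show ?thesis using orient[OF uw(1,2) m uw(3) 4] by simp
        qed (simp_all)
      qed
      let ?a = "(- e) *\<^sub>R perp (f w - f u)"
      have "?a \<noteq> 0" using e inj uw by (auto simp: inj_on_def)
      moreover have "?a \<bullet> f m \<le> ?a \<bullet> f u" "?a \<bullet> f m \<le> ?a \<bullet> f w" if "m \<in> H" for m
        using pos[OF that] by (simp_all add: inner_perp cross_def algebra_simps)
      ultimately show ?thesis using uw(1,2) boundaryI[of _ "f ` H" ?a] by blast
    qed
    show "v \<in> boundary (f ` H)"
    proof (cases "\<exists>j\<in>H. i < j")
      case True
      define j where "j = Min {j\<in>H. i < j}"
      have "j \<in> {j\<in>H. i < j}" unfolding j_def using H(1) True by (intro Min_in) auto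
      moreover have "j \<le> m" if "m \<in> H" "i < m" for m
        unfolding j_def using that H(1) by (intro Min_le) auto
      ultimately show ?thesis using support[of i j] i by (force simp: not_less)
    next
      case False
      have "\<not> H \<subseteq> {i}" using H card_mono[of "{i}" H] by auto
      then obtain j where "j \<in> H" "j \<noteq> i" by blast
      then have ex: "\<exists>j\<in>H. j < i" using False by (meson linorder_neqE_nat)
      define j where "j = Max {j\<in>H. j < i}"
      have "j \<in> {j\<in>H. j < i}" unfolding j_def using H(1) ex by (intro Max_in) auto
      moreover have "m \<le> j" if "m \<in> H" "m < i" for m
        unfolding j_def using that H(1) by (intro Max_ge) auto
      ultimately show ?thesis using support[of j i] i by (force simp: not_less)
    qed
  qed
qed

lemma general_position_cross:
  assumes "general_position P" "p \<in> P" "q \<in> P" "r \<in> P" "p \<noteq> q" "p \<noteq> r" "q \<noteq> r"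
  shows "cross (q - p) (r - p) \<noteq> 0"
proof
  assume "cross (q - p) (r - p) = 0"
  then have "collinear {q, p, r}" using collinear_iff_cross assms(5) by metis
  moreover have "card {q, p, r} = 3" "{q, p, r} \<subseteq> P" using assms by auto
  ultimately show False using assms(1) unfolding general_position_def by blast
qed

theorem Erdos_Szekeres:
  "\<exists>n. \<forall>P. finite P \<and> card P \<ge> n \<and> general_position P \<longrightarrow>
    (\<exists>X. X \<subseteq> P \<and> card X = k \<and> convex_position X)"
proof -
  \<comment> \<open>Orientations say something only about sets with at least three points; a subset
    of size \<open>k\<close> is taken at the end.\<close>
  define k' where "k' = max k 3"
  obtain N :: nat where N: "partn_lst {..<N} [k', k'] 3" using ramsey_full by blast
  show ?thesis
  proof (intro exI[of _ N] allI impI)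
    fix P :: "point set"
    assume P: "finite P \<and> card P \<ge> N \<and> general_position P"
    obtain f where f: "bij_betw f {..<card P} P"
      using P ex_bij_betw_nat_finite[of P] by (auto simp: atLeast0LessThan)
    define or where "or = (\<lambda>i j m. cross (f j - f i) (f m - f i))"
    \<comment> \<open>The colour of a triple is the orientation of its points in increasing order of
      index. General position excludes orientation zero, so colour \<open>1\<close> means
      negative.\<close>
    define c :: "nat set \<Rightarrow> nat" where
      "c = (\<lambda>D. let xs = sorted_list_of_set D in if 0 < or (xs!0) (xs!1) (xs!2) then 0 else 1)"
    have "partn_lst {..<card P} [k', k'] 3" using partn_lst_greater_resource N P by blast
    moreover have "c \<in> nsets {..<card P} 3 \<rightarrow> {..<length [k', k']}" by (auto simp: c_def Let_def)
    ultimately obtain i H where i: "i < length [k', k']"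
      and H: "H \<in> nsets {..<card P} ([k', k'] ! i)" "c ` nsets H 3 \<subseteq> {i}"
      by (rule partn_lstE[where l = "length [k', k']"]) auto
    have ki: "[k', k'] ! i = k'" using i by (auto simp: less_Suc_eq)
    have H': "H \<subseteq> {..<card P}" "finite H" "card H = k'" using H(1) ki by (auto simp: nsets_def)
    have inj: "inj_on f H" using f H'(1) by (meson bij_betw_imp_inj_on inj_on_subset)
    define e :: real where "e = (if i = 0 then 1 else -1)"
    have "0 < e * or u v w" if uvw: "u \<in> H" "v \<in> H" "w \<in> H" "u < v" "v < w" for u v w
    proof -
      have "{u, v, w} \<in> nsets H 3" using uvw by (auto simp: nsets_def)
      then have "c {u, v, w} = i" using H(2) by blast
      moreover have "sorted_list_of_set {u, v, w} = [u, v, w]"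
        using uvw by (auto simp: insert_commute)
      ultimately have *: "(if 0 < or u v w then 0 else 1) = i" by (simp add: c_def)
      have "f u \<in> P" "f v \<in> P" "f w \<in> P" using f H'(1) uvw by (auto simp: bij_betw_def)
      moreover have "f u \<noteq> f v" "f u \<noteq> f w" "f v \<noteq> f w"
        using inj uvw by (auto simp: inj_on_def)
      ultimately have "or u v w \<noteq> 0" using general_position_cross P by (auto simp: or_def)
      with * show ?thesis by (auto simp: e_def split: if_splits)
    qed
    then have boundary: "boundary (f ` H) = f ` H"
      using H' inj by (intro boundary_same_orientation[of _ _ e]) (auto simp: or_def k'_def e_def)
    have "card (f ` H) = k'" using inj H'(3) by (simp add: card_image)
    then obtain X where X: "X \<subseteq> f ` H" "card X = k" "finite X"
      using obtain_subset_with_card_n[of k "f ` H"] by (auto simp: k'_def)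
    have "f ` H \<subseteq> P" using f H'(1) by (auto simp: bij_betw_def)
    then have "X \<subseteq> P" using X(1) by (rule order.trans[rotated])
    moreover have "boundary X = X" using boundary_boundary_subset[of X "f ` H"] boundary X(1) by simp
    then have "convex_position X" by (rule iffD2[OF convex_position_iff[OF X(3)]])
    ultimately show "\<exists>X. X \<subseteq> P \<and> card X = k \<and> convex_position X" using X(2) by auto
  qed
qed

text \<open>A \<open>LEAST\<close> has its defining property only if some admissible number exists,
  which is what the Erdos--Szekeres theorem provides.\<close>

lemma ES_property:
  assumes "finite P" "card P \<ge> Defs.ES k" "general_position P"
  obtains X where "X \<subseteq> P" "card X = k" "convex_position X"
proof -
  have "\<forall>P. finite P \<and> card P \<ge> Defs.ES k \<and> general_position P \<longrightarrow>
    (\<exists>X. X \<subseteq> P \<and> card X = k \<and> convex_position X)"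
    unfolding Defs.ES_def using Erdos_Szekeres by (rule LeastI_ex)
  with assms that show ?thesis by blast
qed

section \<open>Perturbation along the parabola\<close>

definition curve :: "nat \<Rightarrow> point" where
  "curve i = vector [real i, (real i)\<^sup>2]"

text \<open>Coincidence of first coordinates is a linear equation in \<open>t\<close>, and
  collinearity of a triple a quadratic one. Both have nonzero leading coefficient for distinct
  indices, so only finitely many \<open>t\<close> are bad.\<close>

lemma generic_shift:
  fixes f :: "nat \<Rightarrow> point"
  shows "finite {t. \<exists>i<n. \<exists>j<n. i \<noteq> j \<and> f i + t *\<^sub>R curve i = f j + t *\<^sub>R curve j}" (is "finite ?A")
    and "finite {t. \<exists>i<n. \<exists>j<n. \<exists>m<n. i \<noteq> j \<and> i \<noteq> m \<and> j \<noteq> m \<and>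
      cross ((f j + t *\<^sub>R curve j) - (f i + t *\<^sub>R curve i))
        ((f m + t *\<^sub>R curve m) - (f i + t *\<^sub>R curve i)) = 0}" (is "finite ?B")
proof -
  have "?A \<subseteq> (\<Union>i\<in>{..<n}. \<Union>j\<in>{..<n}. {(f j $ 1 - f i $ 1) / (real i - real j)})"
  proof
    fix t assume "t \<in> ?A"
    then obtain i j where ij: "i < n" "j < n" "i \<noteq> j" "f i + t *\<^sub>R curve i = f j + t *\<^sub>R curve j"
      by blast
    from ij(4) have "(f i + t *\<^sub>R curve i) $ 1 = (f j + t *\<^sub>R curve j) $ 1" by simp
    then have "t * (real i - real j) = f j $ 1 - f i $ 1" by (simp add: curve_def algebra_simps)
    then have "t = (f j $ 1 - f i $ 1) / (real i - real j)" using ij(3) by (simp add: field_simps)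
    with ij show "t \<in> (\<Union>i\<in>{..<n}. \<Union>j\<in>{..<n}. {(f j $ 1 - f i $ 1) / (real i - real j)})" by blast
  qed
  then show "finite ?A" by (rule finite_subset) auto
  let ?R = "\<lambda>i j m. {t. i \<noteq> j \<and> i \<noteq> m \<and> j \<noteq> m \<and>
      cross ((f j + t *\<^sub>R curve j) - (f i + t *\<^sub>R curve i))
        ((f m + t *\<^sub>R curve m) - (f i + t *\<^sub>R curve i)) = 0}"
  have "finite (?R i j m)" for i j m
  proof (cases "i \<noteq> j \<and> i \<noteq> m \<and> j \<noteq> m")
    case True
    let ?u = "f j - f i" and ?w = "f m - f i" and ?u' = "curve j - curve i" and ?w' = "curve m - curve i"
    define q where "q = [: cross ?u ?w, cross ?u ?w' + cross ?u' ?w, cross ?u' ?w' :]"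
    \<comment> \<open>The Vandermonde determinant of the three parameters, which is the leading
      coefficient of \<open>q\<close>.\<close>
    have "cross ?u' ?w' = (real j - real i) * (real m - real i) * (real m - real j)"
      by (simp add: cross_def curve_def power2_eq_square algebra_simps)
    then have "q \<noteq> 0" using True by (simp add: q_def)
    moreover have "?R i j m \<subseteq> {t. poly q t = 0}"
      by (auto simp: q_def cross_def algebra_simps)
    ultimately show ?thesis using poly_roots_finite finite_subset by blast
  next
    case False
    then show ?thesis by (auto intro: finite_subset[of _ "{}"])
  qed
  then have "finite (\<Union>i\<in>{..<n}. \<Union>j\<in>{..<n}. \<Union>m\<in>{..<n}. ?R i j m)" by simp
  moreover have "?B \<subseteq> (\<Union>i\<in>{..<n}. \<Union>j\<in>{..<n}. \<Union>m\<in>{..<n}. ?R i j m)" by blast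
  ultimately show "finite ?B" by (rule finite_subset[rotated])
qed

text \<open>For point sets that are not in general position, perturb along the moment curve and pass to
  the limit of the supporting functionals.\<close>

lemma weak_convex_subset:
  assumes fin: "finite P" and card: "card P \<ge> Defs.ES k"
  obtains X where "X \<subseteq> P" "card X = k" "boundary X = X"
proof -
  define n where "n = card P"
  obtain f where f: "bij_betw f {..<n} P"
    using fin ex_bij_betw_nat_finite[of P] by (auto simp: atLeast0LessThan n_def)
  define p where "p = (\<lambda>t i. f i + t *\<^sub>R curve i)"
  \<comment> \<open>Normals are normalised so that they cannot tend to zero, and subsets are
    recorded by indices so that they can be compared for different \<open>t\<close>.\<close>
  have "\<exists>t I a. 0 < t \<and> t < inverse (real (Suc N)) \<and> I \<subseteq> {..<n} \<and> card I = k \<and>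
     (\<forall>i\<in>I. norm (a i) = 1 \<and> (\<forall>j\<in>I. a i \<bullet> p t j \<le> a i \<bullet> p t i))" for N
  proof -
    define A where "A = {t. \<exists>i<n. \<exists>j<n. i \<noteq> j \<and> p t i = p t j}"
    define B where "B = {t. \<exists>i<n. \<exists>j<n. \<exists>m<n. i \<noteq> j \<and> i \<noteq> m \<and> j \<noteq> m \<and>
      cross (p t j - p t i) (p t m - p t i) = 0}"
    have fin_AB: "finite (A \<union> B)" using generic_shift[of n f] unfolding A_def B_def p_def by simp
    have "\<not> {0<..<inverse (real (Suc N))} \<subseteq> A \<union> B"
    proof
      assume "{0<..<inverse (real (Suc N))} \<subseteq> A \<union> B"
      then have "finite {0<..<inverse (real (Suc N))}" using fin_AB by (rule finite_subset)
      moreover have "infinite {0<..<inverse (real (Suc N))}" by (rule infinite_Ioo) simp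
      ultimately show False by contradiction
    qed
    then obtain t where t': "t \<in> {0<..<inverse (real (Suc N))}" "t \<notin> A" "t \<notin> B" by blast
    have t: "0 < t" "t < inverse (real (Suc N))"
      "\<And>i j. i < n \<Longrightarrow> j < n \<Longrightarrow> i \<noteq> j \<Longrightarrow> p t i \<noteq> p t j"
      "\<And>i j m. i < n \<Longrightarrow> j < n \<Longrightarrow> m < n \<Longrightarrow> i \<noteq> j \<Longrightarrow> i \<noteq> m \<Longrightarrow> j \<noteq> m \<Longrightarrow>
        cross (p t j - p t i) (p t m - p t i) \<noteq> 0"
      using t'(1) apply simp_all
      using t'(2,3) unfolding A_def B_def by blast+
    have inj: "inj_on (p t) {..<n}" using t(3) by (auto simp: inj_on_def)
    have "general_position (p t ` {..<n})"
      unfolding general_position_def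
    proof safe
      fix X assume X: "X \<subseteq> p t ` {..<n}" "card X = 3" "collinear X"
      obtain x y w where xyw: "X = {x, y, w}" "x \<noteq> y" "x \<noteq> w" "y \<noteq> w"
        using X(2) by (auto simp: card_3_iff)
      obtain i j m where ijm: "i < n" "j < n" "m < n" "x = p t i" "y = p t j" "w = p t m"
        using X(1) xyw(1) by auto
      have "cross (p t i - p t j) (p t m - p t j) = 0"
        using X(3) collinear_iff_cross[of x y w] xyw ijm by simp
      moreover have "i \<noteq> j" "i \<noteq> m" "j \<noteq> m" using xyw ijm by auto
      ultimately show False using t(4)[of j i m] ijm by auto
    qed
    moreover have "card (p t ` {..<n}) \<ge> Defs.ES k" using card inj by (simp add: card_image n_def)
    ultimately obtain X where X: "X \<subseteq> p t ` {..<n}" "card X = k" "convex_position X"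
      using ES_property[of "p t ` {..<n}" k] by blast
    then obtain I where I: "I \<subseteq> {..<n}" "X = p t ` I" by (meson subset_imageE)
    have "card I = k" using X(2) I inj by (metis card_image inj_on_subset)
    have "finite X" using X(1) finite_subset by blast
    then have bdX: "boundary X = X" using X(3) convex_position_iff by blast
    have "\<exists>a. norm a = 1 \<and> (\<forall>j\<in>I. a \<bullet> p t j \<le> a \<bullet> p t i)" if "i \<in> I" for i
    proof -
      have "p t i \<in> boundary X" using that I(2) bdX by blast
      then obtain a where a: "a \<noteq> 0" "\<forall>j\<in>I. a \<bullet> p t j \<le> a \<bullet> p t i"
        using I(2) by (auto simp: boundary_def)
      then show ?thesis
        by (intro exI[of _ "(1 / norm a) *\<^sub>R a"]) (auto simp: divide_right_mono)
    qed
    then obtain a where "\<forall>i\<in>I. norm (a i) = 1 \<and> (\<forall>j\<in>I. a i \<bullet> p t j \<le> a i \<bullet> p t i)"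
      by metis
    then show ?thesis using t(1,2) I(1) \<open>card I = k\<close> by blast
  qed
  then obtain t I a where tIa: "\<And>N. 0 < t N" "\<And>N. t N < inverse (real (Suc N))"
    "\<And>N. I N \<subseteq> {..<n}" "\<And>N. card (I N) = k"
    "\<And>N i. i \<in> I N \<Longrightarrow> norm (a N i) = 1"
    "\<And>N i j. i \<in> I N \<Longrightarrow> j \<in> I N \<Longrightarrow> a N i \<bullet> p (t N) j \<le> a N i \<bullet> p (t N) i"
    by metis
  have t0: "t \<longlonglongrightarrow> 0"
    by (rule tendsto_sandwich[OF _ _ tendsto_const LIMSEQ_inverse_real_of_nat])
       (use tIa(1,2) in \<open>auto intro!: always_eventually less_imp_le\<close>)
  have "range I \<subseteq> Pow {..<n}" using tIa(3) by blast
  then have "finite (range I)" by (rule finite_subset) simp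
  \<comment> \<open>One of the finitely many index sets occurs infinitely often; along it,
    compactness of the unit circle gives limits of the normals.\<close>
  then obtain N0 where N0: "infinite {N \<in> UNIV. I N = I N0}"
    using pigeonhole_infinite[of UNIV I] by auto
  obtain r :: "nat \<Rightarrow> nat" where r: "strict_mono r" "\<And>m. I (r m) = I N0"
    using infinite_enumerate[OF N0] by auto
  have support: "\<exists>b. b \<noteq> 0 \<and> (\<forall>j\<in>I N0. b \<bullet> f j \<le> b \<bullet> f i)" if i: "i \<in> I N0" for i
  proof -
    have "\<forall>m. a (r m) i \<in> sphere 0 1" using tIa(5) r(2) i by simp
    then obtain b s where b: "b \<in> sphere 0 1" "strict_mono s" "((\<lambda>m. a (r m) i) \<circ> s) \<longlonglongrightarrow> b"
      using compact_sphere[of 0 1] unfolding compact_def by metis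
    have ts: "(\<lambda>m. t (r (s m))) \<longlonglongrightarrow> 0"
      using LIMSEQ_subseq_LIMSEQ[OF LIMSEQ_subseq_LIMSEQ[OF t0 r(1)] b(2)] by (simp add: o_def)
    have lim: "(\<lambda>m. a (r (s m)) i \<bullet> p (t (r (s m))) j) \<longlonglongrightarrow> b \<bullet> (f j + 0 *\<^sub>R curve j)" for j
      unfolding p_def using b(3) ts by (intro tendsto_intros) (auto simp: o_def)
    have "b \<bullet> f j \<le> b \<bullet> f i" if j: "j \<in> I N0" for j
      using LIMSEQ_le[OF lim[of j] lim[of i]] tIa(6)[of i "r _" j] i j r(2) by auto
    moreover have "b \<noteq> 0" using b(1) by auto
    ultimately show ?thesis by blast
  qed
  have inj: "inj_on f (I N0)" using f tIa(3) by (meson bij_betw_imp_inj_on inj_on_subset)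
  have "boundary (f ` I N0) = f ` I N0" using support by (auto simp: boundary_def)
  moreover have "card (f ` I N0) = k" using inj tIa(4) by (simp add: card_image)
  moreover have "f ` I N0 \<subseteq> P" using f tIa(3)[of N0] by (auto simp: bij_betw_def)
  ultimately show ?thesis using that by blast
qed

section \<open>Minimal hulls and collinear points\<close>

text \<open>The quotient is the sum \<open>1 + q + ... + q ^ (l - 1)\<close>, bounded below by its
  last term.\<close>

lemma geometric_quotient_ge:
  fixes q l :: nat
  assumes "2 \<le> q" "1 \<le> l"
  shows "q ^ (l - 1) \<le> (q ^ l - 1) div (q - 1)"
proof -
  have "q ^ (l - 1) * (q - 1) = q ^ (l - 1) * q - q ^ (l - 1)"
    by (simp only: diff_mult_distrib2 mult_1_right)
  also have "q ^ (l - 1) * q = q ^ l" using assms(2) by (cases l) auto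
  also have "q ^ l - q ^ (l - 1) \<le> q ^ l - 1" using assms(1) by (intro diff_le_mono2) simp
  finally have "q ^ (l - 1) * (q - 1) \<le> q ^ l - 1" .
  then show ?thesis using assms(1) by (simp add: less_eq_div_iff_mult_less_eq)
qed

text \<open>With \<open>m = l - 3\<close>, the left side bounds the outer layer when there are at
  most \<open>l - 1\<close> layers. For \<open>m \<ge> 2\<close>, \<open>(2 * m + 5) ^ m\<close> is
  at least \<open>8 ^ m\<close>, hence at least \<open>16 * 2 ^ m\<close>, and the factor
  \<open>16\<close> outweighs the ratio of the quadratic factors.\<close>

lemma layer_numbers:
  fixes m :: nat
  shows "2 ^ m * ((6 * m + 4) * (6 * m + 5)) < (2 * m + 5) ^ (m + 2)"
proof -
  have sq: "(2 * m + 5) ^ (m + 2) = (2 * m + 5) ^ m * ((2 * m + 5) * (2 * m + 5))"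
    by (simp add: power_add power2_eq_square)
  consider "m = 0" | "m = 1" | "2 \<le> m" by linarith
  then show ?thesis
  proof cases
    case 3
    have "2 ^ m * 16 \<le> 2 ^ m * (4::nat) ^ m"
      using power_increasing[of 2 m "4::nat"] 3 by simp
    also have "\<dots> = 8 ^ m" by (simp add: power_mult_distrib[symmetric])
    also have "\<dots> \<le> (2 * m + 5) ^ m" using 3 by (intro power_mono) auto
    finally have "2 ^ m * 16 * ((2 * m + 5) * (2 * m + 5)) \<le> (2 * m + 5) ^ (m + 2)"
      unfolding sq by (rule mult_right_mono) simp
    moreover have "(6 * m + 4) * (6 * m + 5) < 16 * ((2 * m + 5) * (2 * m + 5))"
      by (simp add: algebra_simps)
    then have "2 ^ m * ((6 * m + 4) * (6 * m + 5)) < 2 ^ m * (16 * ((2 * m + 5) * (2 * m + 5)))"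
      by (rule mult_strict_left_mono) simp
    ultimately show ?thesis by (simp only: mult.assoc)
  qed (simp_all add: numeral_eq_Suc)
qed

lemma funpow_peel_subset: "i \<le> j \<Longrightarrow> (peel ^^ j) Q \<subseteq> (peel ^^ i) Q"
proof (induction j)
  case (Suc j)
  then show ?case using peel_subset[of "(peel ^^ j) Q"] by (auto simp: le_Suc_eq)
qed simp

text \<open>Peeling preserves \<open>hull_closed\<close> and removes points, so by minimality the
  second layer has fewer than \<open>k\<close> points. The search starts from all points of
  \<open>P\<close> in the hull of \<open>X\<close>, where \<open>X\<close> stays on the
  boundary.\<close>

lemma minimal_hull_closed:
  assumes fin: "finite P" and X: "X \<subseteq> P" "card X = k" "boundary X = X" and k: "0 < k"
  obtains Q where "hull_closed P Q" "k \<le> card (boundary Q)" "card (boundary (peel Q)) < card (boundary Q)"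
proof -
  let ?ok = "\<lambda>Q. hull_closed P Q \<and> k \<le> card (boundary Q)"
  have finR: "finite Q" if "hull_closed P Q" for Q
    using that fin finite_subset by (auto simp: hull_closed_def)
  define Q0 where "Q0 = P \<inter> convex hull X"
  have XQ: "X \<subseteq> Q0" using X(1) hull_subset[of X convex] by (auto simp: Q0_def)
  have "convex hull Q0 \<subseteq> convex hull X"
    unfolding Q0_def by (intro hull_minimal convex_convex_hull) blast
  then have rel: "hull_closed P Q0" by (auto simp: hull_closed_def Q0_def)
  have "X \<subseteq> boundary Q0"
  proof
    fix x assume "x \<in> X"
    then obtain a where a: "a \<noteq> 0" "\<And>y. y \<in> X \<Longrightarrow> a \<bullet> y \<le> a \<bullet> x"
      using X(3) by (force simp: boundary_def)
    have "a \<bullet> y \<le> a \<bullet> x" if "y \<in> Q0" for y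
      by (rule inner_le_convex_hull[OF a(2)]) (use that in \<open>auto simp: Q0_def\<close>)
    then show "x \<in> boundary Q0" using boundaryI XQ \<open>x \<in> X\<close> a(1) by blast
  qed
  then have "k \<le> card (boundary Q0)" using X(2) finite_boundary[OF finR[OF rel]] card_mono by blast
  with rel have "?ok Q0" by simp
  then obtain Q where Q: "?ok Q" "\<And>R. ?ok R \<Longrightarrow> card Q \<le> card R"
    using ex_has_least_nat[of ?ok Q0 card] by blast
  have "card (boundary (peel Q)) < k"
  proof (rule ccontr)
    assume "\<not> card (boundary (peel Q)) < k"
    then have "card Q \<le> card (peel Q)" using Q(1) hull_closed_peel by (intro Q(2)) auto
    moreover have "boundary Q \<noteq> {}" using Q(1) k by auto
    then have "peel Q \<subset> Q" using boundary_subset by (auto simp: peel_def)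
    then have "card (peel Q) < card Q" using finR Q(1) by (intro psubset_card_mono) auto
    ultimately show False by simp
  qed
  with Q(1) that show ?thesis by force
qed

theorem theorem3:
  fixes l :: nat and P :: "point set"
  assumes "l \<ge> 2"
    and "finite P"
    and "card P \<ge> ES (((2 * l - 1) ^ l - 1) div (2 * l - 2))"
  shows "(\<exists>X. X \<subseteq> P \<and> card X = l \<and> collinear X) \<or> (\<exists>H. five_hole P H)"
proof (rule ccontr)
  assume neg: "\<not> ?thesis"
  then have nohole: "\<nexists>H. five_hole P H" by blast
  have nocol: "card X < l" if "X \<subseteq> P" "collinear X" for X
  proof (rule ccontr)
    assume "\<not> card X < l"
    then obtain Y where "Y \<subseteq> X" "card Y = l" using obtain_subset_with_card_n[of l X] by auto
    then show False using neg that collinear_subset by blast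
  qed
  define k where "k = ((2 * l - 1) ^ l - 1) div (2 * l - 2)"
  have kge: "(2 * l - 1) ^ (l - 1) \<le> k"
  proof -
    have eq: "2 * l - 2 = 2 * l - 1 - 1" by simp
    show ?thesis unfolding k_def eq using assms(1) by (intro geometric_quotient_ge) auto
  qed
  moreover have "l \<le> 2 * l - 1" using assms(1) by simp
  moreover have "2 * l - 1 \<le> (2 * l - 1) ^ (l - 1)" using assms(1) by (intro self_le_power) auto
  ultimately have lk: "l \<le> k" by linarith
  obtain X where X: "X \<subseteq> P" "card X = k" "boundary X = X"
    using weak_convex_subset assms(2,3) k_def by metis
  \<comment> \<open>Two points are always collinear, so \<open>l = 2\<close> is settled here and
    \<open>l - 3\<close> is a true subtraction from now on.\<close>
  have l3: "3 \<le> l"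
  proof (rule ccontr)
    assume "\<not> 3 \<le> l"
    then have "l = 2" using assms(1) by simp
    then obtain Y where Y: "Y \<subseteq> X" "card Y = 2"
      using obtain_subset_with_card_n[of 2 X] lk X(2) by auto
    then have "collinear Y" by (auto simp: card_2_iff)
    then show False using nocol[of Y] Y X(1) \<open>l = 2\<close> by auto
  qed
  obtain Q where Q: "hull_closed P Q" "k \<le> card (boundary Q)" "card (boundary (peel Q)) < card (boundary Q)"
    using minimal_hull_closed[OF assms(2) X] lk l3 by auto
  define m where "m = l - 3"
  have l: "l = m + 3" using l3 by (simp add: m_def)
  have "(peel ^^ (m + 2)) Q \<noteq> {}"
  proof
    assume "(peel ^^ (m + 2)) Q = {}"
    from layers_bound[OF assms(2) nohole l3 nocol Q(1) this]
    have "card (boundary Q) \<le> 2 ^ m * ((6 * m + 4) * (6 * m + 5))"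
      by (simp add: l algebra_simps)
    also have "\<dots> < (2 * m + 5) ^ (m + 2)" by (rule layer_numbers)
    also have "2 * m + 5 = 2 * l - 1" by (simp add: l)
    also have "m + 2 = l - 1" by (simp add: l)
    finally show False using kge Q(2) by simp
  qed
  then obtain z where z: "z \<in> (peel ^^ (m + 2)) Q" by blast
  have "(peel ^^ (m + 2)) Q \<subseteq> (peel ^^ 2) Q" by (rule funpow_peel_subset) simp
  then have "z \<in> peel (peel Q)" using z by (auto simp: numeral_2_eq_2)
  then obtain d where d: "lead Q z d" using lead_exists[OF assms(2) Q(1) nohole _ Q(3)] by blast
  have "\<forall>i\<in>{..m + 1}. \<exists>p. p \<in> boundary ((peel ^^ i) Q) \<and> on_ray z d p"
    using lead_funpow[OF assms(2) Q(1) nohole z d] by (simp add: Bex_def)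
  then obtain p where p: "\<And>i. i \<le> m + 1 \<Longrightarrow> p i \<in> boundary ((peel ^^ i) Q)"
    "\<And>i. i \<le> m + 1 \<Longrightarrow> on_ray z d (p i)"
    by (metis atMost_iff)
  \<comment> \<open>Points of a layer are absent from all deeper sets, so the points on the ray
    differ from each other and from \<open>z\<close>.\<close>
  have outside: "p i \<notin> (peel ^^ j) Q" if "i \<le> m + 1" "i < j" for i j
  proof -
    have "(peel ^^ j) Q \<subseteq> (peel ^^ Suc i) Q" using that(2) by (intro funpow_peel_subset) simp
    moreover have "p i \<notin> peel ((peel ^^ i) Q)" using p(1)[OF that(1)] by (simp add: peel_def)
    ultimately show ?thesis by auto
  qed
  have inside: "p i \<in> (peel ^^ i) Q" if "i \<le> m + 1" for i using p(1)[OF that] boundary_subset by blast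
  \<comment> \<open>One point from each of the \<open>m + 2 = l - 1\<close> outermost layers,
    together with \<open>z\<close>, makes \<open>l\<close> points.\<close>
  let ?Y = "insert z (p ` {..m + 1})"
  have "inj_on p {..m + 1}"
  proof (rule linorder_inj_onI)
    fix i j assume "i < j" "i \<in> {..m + 1}" "j \<in> {..m + 1}"
    then show "p i \<noteq> p j" using outside[of i j] inside[of j] by auto
  qed auto
  moreover have "z \<notin> p ` {..m + 1}"
  proof
    assume "z \<in> p ` {..m + 1}"
    then obtain i where "i \<le> m + 1" "z = p i" by auto
    then show False using outside[of i "m + 2"] z by simp
  qed
  ultimately have "card ?Y = l" by (simp add: card_image l)
  moreover have "?Y \<subseteq> P"
  proof -
    have "(peel ^^ i) Q \<subseteq> P" for i using funpow_peel_subset[of 0 i Q] Q(1) by (auto simp: hull_closed_def)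
    then show ?thesis using z inside by blast
  qed
  moreover have "collinear ?Y"
  proof -
    have "\<exists>c. y - z = c *\<^sub>R d" if "y \<in> ?Y" for y
      using that p(2) by (auto simp: on_ray_def intro: exI[of _ 0])
    then obtain c where c: "\<And>y. y \<in> ?Y \<Longrightarrow> y - z = c y *\<^sub>R d" by metis
    have "x - y = (c x - c y) *\<^sub>R d" if "x \<in> ?Y" "y \<in> ?Y" for x y
    proof -
      have "x - y = (x - z) - (y - z)" by simp
      also have "\<dots> = (c x - c y) *\<^sub>R d" using c that by (simp add: scaleR_left_diff_distrib)
      finally show ?thesis .
    qed
    then show ?thesis unfolding collinear_def by blast
  qed
  ultimately show False using nocol[of ?Y] by simp
qed

end
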